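(* Suppose $n>1$ and let $k\in\mathbb{N}$. Then $\mathcal{H}_k$ is an irreducible $osp(2n|2m)$-module if and only if $k\leq m+1-n$ or $k>2(m+1-n)$. When $k\leq m+1-n$, $\mathcal{A}_k=\bigoplus_{i=0}^{\lfloor k/2\rfloor}\eta^i\mathcal{H}_{k-2i}$ is a decomposition of $\mathcal{A}_k$ into irreducible $osp(2n|2m)$-submodules.
   Context: Fix positive integers $n,m$. Let $\mathcal{A}$ be the complex supercommutative polynomial algebra in even variables $x_1,\dots,x_n,y_1,\dots,y_n$ and odd (mutually anticommuting) variables $\theta_1,\dots,\theta_m,\vartheta_1,\dots,\vartheta_m$, with usual partial derivatives $\partial_{x_i},\partial_{y_i}$ and odd derivations $\partial_{\theta_r},\partial_{\vartheta_r}$ (for odd $\tau$: $\partial_\tau(\tau')=\delta_{\tau,\tau'}$ on odd variables, kills even variables, $\partial_\tau(fg)=\partial_\tau(f)g+(-1)^\iota f\partial_\tau(g)$ for $f$ of parity $\iota$). In $gl(2n|2m)$ (matrix units $E_{a,b}$, $a,b\in\{1,\dots,2n+2m\}$, indices $\le 2n$ even, the others odd), $osp(2n|2m)$ is the subsuperalgebra spanned by the following elements, which act on $\mathcal{A}$ by the indicated operators ($i,j\in\{1,..,n\}$, $r,s\in\{1,..,m\}$): $E_{i,j}-E_{n+j,n+i}\mapsto x_i\partial_{x_j}-y_j\partial_{y_i}$; $E_{2n+r,2n+s}-E_{2n+m+s,2n+m+r}\mapsto\theta_r\partial_{\theta_s}-\vartheta_s\partial_{\vartheta_r}$; $E_{i,2n+r}-E_{2n+m+r,n+i}\mapsto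 x_i\partial_{\theta_r}-\vartheta_r\partial_{y_i}$; $E_{2n+r,i}+E_{n+i,2n+m+r}\mapsto\theta_r\partial_{x_i}+y_i\partial_{\vartheta_r}$; for $i<j$: $E_{i,n+j}-E_{j,n+i}\mapsto x_i\partial_{y_j}-x_j\partial_{y_i}$ and $E_{n+i,j}-E_{n+j,i}\mapsto y_i\partial_{x_j}-y_j\partial_{x_i}$; for $r\le s$: $E_{2n+m+r,2n+s}+E_{2n+m+s,2n+r}\mapsto\vartheta_r\partial_{\theta_s}+\vartheta_s\partial_{\theta_r}$ and $E_{2n+r,2n+m+s}+E_{2n+s,2n+m+r}\mapsto\theta_r\partial_{\vartheta_s}+\theta_s\partial_{\vartheta_r}$; $E_{i,2n+m+r}+E_{2n+r,n+i}\mapsto x_i\partial_{\vartheta_r}+\theta_r\partial_{y_i}$; $E_{n+i,2n+r}-E_{2n+m+r,i}\mapsto y_i\partial_{\theta_r}-\vartheta_r\partial_{x_i}$. This defines a representation of $osp(2n|2m)$ on $\mathcal{A}$. For $k\in\mathbb{N}$, $\mathcal{A}_k$ is the span of monomials $x^\alpha y^\beta\theta_{i_1}\cdots\theta_{i_a}\vartheta_{j_1}\cdots\vartheta_{j_b}$ with $|\alpha|+|\beta|+a+b=k$ (total degree $k$). $\Delta=\sum_{i=1}^n\partial_{x_i}\partial_{y_i}+\sum_{r=1}^m\partial_{\theta_r}\partial_{\vartheta_r}$, $\eta=\sum_{i=1}^nx_iy_i+\sum_{r=1}^m\theta_r\vartheta_r$ (multiplication), and $\mathcal{H}_k=\{f\in\mathcal{A}_k\mid\Delta(f)=0\}$,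 an $osp(2n|2m)$-submodule. *)

theory Defs
  imports Complex_Main
begin

text \<open>Encoding of the superpolynomial algebra.
 Even variables: x_i has index i, y_i has index n+i (i in 1..n).
 Odd variables: theta_r has index r, vartheta_r has index m+r (r in 1..m).
 A monomial x^alpha y^beta theta... vartheta... is a pair (a, U) where
 a :: nat => nat gives the exponents of the even variables and U is the set of
 odd variables occurring, the odd product being taken in increasing index order.
 A superpolynomial is its coefficient function.\<close>

type_synonym smon = "(nat \<Rightarrow> nat) \<times> nat set"
type_synonym spoly = "smon \<Rightarrow> complex"

definition mul_ev :: "nat \<Rightarrow> spoly \<Rightarrow> spoly" where
  "mul_ev e p = (\<lambda>(a, U). if 0 < a e then p (a(e := a e - 1), U) else 0)"

definition der_ev :: "nat \<Rightarrow> spoly \<Rightarrow> spoly" where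
  "der_ev e p = (\<lambda>(a, U). of_nat (a e + 1) * p (a(e := a e + 1), U))"

text \<open>sign for moving the odd variable t past the odd variables of U below t\<close>
definition osign :: "nat set \<Rightarrow> nat \<Rightarrow> complex" where
  "osign U t = (-1) ^ card {u \<in> U. u < t}"

text \<open>left multiplication by / (left) odd derivation with respect to the odd variable t\<close>
definition mul_od :: "nat \<Rightarrow> spoly \<Rightarrow> spoly" where
  "mul_od t p = (\<lambda>(a, U). if t \<in> U then osign U t * p (a, U - {t}) else 0)"

definition der_od :: "nat \<Rightarrow> spoly \<Rightarrow> spoly" where
  "der_od t p = (\<lambda>(a, U). if t \<notin> U then osign U t * p (a, insert t U) else 0)"

definition padd :: "(spoly \<Rightarrow> spoly) \<Rightarrow> (spoly \<Rightarrow> spoly) \<Rightarrow> spoly \<Rightarrow> spoly" where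
  "padd F G = (\<lambda>p \<mu>. F p \<mu> + G p \<mu>)"

definition psub :: "(spoly \<Rightarrow> spoly) \<Rightarrow> (spoly \<Rightarrow> spoly) \<Rightarrow> spoly \<Rightarrow> spoly" where
  "psub F G = (\<lambda>p \<mu>. F p \<mu> - G p \<mu>)"

text \<open>The operators by which the spanning elements of osp(2n|2m) act.\<close>
definition osp_ops :: "nat \<Rightarrow> nat \<Rightarrow> (spoly \<Rightarrow> spoly) set" where
  "osp_ops n m =
     {psub (mul_ev i \<circ> der_ev j) (mul_ev (n+j) \<circ> der_ev (n+i)) | i j. i \<in> {1..n} \<and> j \<in> {1..n}}
   \<union> {psub (mul_od r \<circ> der_od s) (mul_od (m+s) \<circ> der_od (m+r)) | r s. r \<in> {1..m} \<and> s \<in> {1..m}}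
   \<union> {psub (mul_ev i \<circ> der_od r) (mul_od (m+r) \<circ> der_ev (n+i)) | i r. i \<in> {1..n} \<and> r \<in> {1..m}}
   \<union> {padd (mul_od r \<circ> der_ev i) (mul_ev (n+i) \<circ> der_od (m+r)) | i r. i \<in> {1..n} \<and> r \<in> {1..m}}
   \<union> {psub (mul_ev i \<circ> der_ev (n+j)) (mul_ev j \<circ> der_ev (n+i)) | i j. 1 \<le> i \<and> i < j \<and> j \<le> n}
   \<union> {psub (mul_ev (n+i) \<circ> der_ev j) (mul_ev (n+j) \<circ> der_ev i) | i j. 1 \<le> i \<and> i < j \<and> j \<le> n}
   \<union> {padd (mul_od (m+r) \<circ> der_od s) (mul_od (m+s) \<circ> der_od r) | r s. 1 \<le> r \<and> r \<le> s \<and> s \<le> m}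
   \<union> {padd (mul_od r \<circ> der_od (m+s)) (mul_od s \<circ> der_od (m+r)) | r s. 1 \<le> r \<and> r \<le> s \<and> s \<le> m}
   \<union> {padd (mul_ev i \<circ> der_od (m+r)) (mul_od r \<circ> der_ev (n+i)) | i r. i \<in> {1..n} \<and> r \<in> {1..m}}
   \<union> {psub (mul_ev (n+i) \<circ> der_od r) (mul_od (m+r) \<circ> der_ev i) | i r. i \<in> {1..n} \<and> r \<in> {1..m}}"

definition valid_mon :: "nat \<Rightarrow> nat \<Rightarrow> smon \<Rightarrow> bool" where
  "valid_mon n m \<mu> = ((\<forall>e. fst \<mu> e \<noteq> 0 \<longrightarrow> e \<in> {1..2*n}) \<and> snd \<mu> \<subseteq> {1..2*m})"

definition mdeg :: "nat \<Rightarrow> smon \<Rightarrow> nat" where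
  "mdeg n \<mu> = (\<Sum>e\<in>{1..2*n}. fst \<mu> e) + card (snd \<mu>)"

definition Ak :: "nat \<Rightarrow> nat \<Rightarrow> nat \<Rightarrow> spoly set" where
  "Ak n m k = {p. \<forall>\<mu>. p \<mu> \<noteq> 0 \<longrightarrow> valid_mon n m \<mu> \<and> mdeg n \<mu> = k}"

definition Lap :: "nat \<Rightarrow> nat \<Rightarrow> spoly \<Rightarrow> spoly" where
  "Lap n m p = (\<lambda>\<mu>. (\<Sum>i=1..n. der_ev i (der_ev (n+i) p) \<mu>) + (\<Sum>r=1..m. der_od r (der_od (m+r) p) \<mu>))"

definition eta :: "nat \<Rightarrow> nat \<Rightarrow> spoly \<Rightarrow> spoly" where
  "eta n m p = (\<lambda>\<mu>. (\<Sum>i=1..n. mul_ev i (mul_ev (n+i) p) \<mu>) + (\<Sum>r=1..m. mul_od r (mul_od (m+r) p) \<mu>))"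

definition Hk :: "nat \<Rightarrow> nat \<Rightarrow> nat \<Rightarrow> spoly set" where
  "Hk n m k = {p \<in> Ak n m k. Lap n m p = (\<lambda>_. 0)}"

definition submodule :: "(spoly \<Rightarrow> spoly) set \<Rightarrow> spoly set \<Rightarrow> bool" where
  "submodule ops W = ((\<lambda>_. 0) \<in> W \<and> (\<forall>f\<in>W. \<forall>g\<in>W. (\<lambda>\<mu>. f \<mu> + g \<mu>) \<in> W)
     \<and> (\<forall>c::complex. \<forall>f\<in>W. (\<lambda>\<mu>. c * f \<mu>) \<in> W) \<and> (\<forall>T\<in>ops. \<forall>f\<in>W. T f \<in> W))"

definition irreducible_submodule :: "(spoly \<Rightarrow> spoly) set \<Rightarrow> spoly set \<Rightarrow> bool" where
  "irreducible_submodule ops W = (submodule ops W \<and> W \<noteq> {\<lambda>_. 0}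
     \<and> (\<forall>W'. submodule ops W' \<and> W' \<subseteq> W \<longrightarrow> W' = {\<lambda>_. 0} \<or> W' = W))"

end

(* Write M = m + 1 - n.

   The operators x_1 d_z - (dual of z) d_{y_1}, for z a variable other than x_1 and y_1, raise
   (x_1-degree) - (y_1-degree), so every nonzero submodule W of H_k contains a nonzero vector f
   killed by all of them.  If f has y_1-degree d, its top part is a multiple of x_1^(k-d) y_1^d;
   for d > 0 comparing leading coefficients in Lap f = 0 gives d = k - M, and 2d <= k because
   n > 1.  So f is a multiple of x_1^k unless M < k <= 2M.

   The bilinear form for which multiplication by a variable is adjoint, up to sign, to the
   derivation is invariant and nonzero on x_1^k.  The orthogonal complement of W in H_k is a
   submodule without x_1^k, hence zero, and counting dimensions gives W = H_k.

   For M < k <= 2M the element eta^(k-M) x_1^(2M-k) is harmonic, whereas x_1^k is not divisible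
   by eta.  The decomposition follows from the sl(2)-relation
   Lap eta^(i+1) h = (i+1)(n - m + l + i) eta^i h for h in H_l, applying Lap to lower k by 2. *)

theory Submission
  imports Defs "HOL-Library.Function_Algebras"
begin

section \<open>Multiplications and derivations\<close>

text \<open>The superspace has superdimension 2n - 2m, and M is 1 minus half of it. For l + 2(i+1) =
  k the factor n - m + l + i of the sl(2)-constant vanishes exactly when i + 1 = k - M and l = 2M -
  k; both are admissible exactly when M < k \<le> 2M. The top monomial that a singular vector with d
  > 0 must have, x_1^M y_1^(k-M), is then the one of eta^(k-M) x_1^(2M-k), so the exceptional range
  is the same from both sides.

  Modules of osp(2n|2m) need not be completely reducible, so a unique singular line does not give
  irreducibility: x_1^k could generate a proper submodule. The form excludes this by duality. The
  singular vector argument is therefore used a second time, on the complement.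

  Only one parabolic nilradical is used. This singles out x_1 and its dual y_1 and treats all other
  variables, even or odd, alike, without a root system.\<close>

lemma sum_fun_apply: "(\<Sum>i\<in>A. f i) x = (\<Sum>i\<in>A. f i x)"
  for f :: "'i \<Rightarrow> 'a \<Rightarrow> 'b::comm_monoid_add"
  by (induction A rule: infinite_finite_induct) auto

text \<open>Named so that superpolynomials become an instance of the locale of vector spaces, from
  which spans, independence and the exchange bound are taken.\<close>

definition smul :: "complex \<Rightarrow> spoly \<Rightarrow> spoly" where
  "smul c p = (\<lambda>\<mu>. c * p \<mu>)"

lemma smul_apply [simp]: "smul c p \<mu> = c * p \<mu>"
  by (simp add: smul_def)

interpretation spoly: vector_space smul
  by standard (auto simp: fun_eq_iff algebra_simps)

interpretation spoly: vector_space_pair smul smul ..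

abbreviation lin :: "(spoly \<Rightarrow> spoly) \<Rightarrow> bool" where
  "lin \<equiv> Vector_Spaces.linear smul smul"

lemma linI: "(\<And>p q. L (p + q) = L p + L q) \<Longrightarrow> (\<And>c p. L (smul c p) = smul c (L p)) \<Longrightarrow> lin L"
  by (simp add: Vector_Spaces.linear_iff spoly.vector_space_axioms)

lemma lin_mul_ev: "lin (mul_ev e)"
  by (rule linI) (auto simp: mul_ev_def fun_eq_iff)

lemma lin_der_ev: "lin (der_ev e)"
  by (rule linI) (auto simp: der_ev_def fun_eq_iff algebra_simps)

lemma lin_mul_od: "lin (mul_od e)"
  by (rule linI) (auto simp: mul_od_def fun_eq_iff algebra_simps)

lemma lin_der_od: "lin (der_od e)"
  by (rule linI) (auto simp: der_od_def fun_eq_iff algebra_simps)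

lemmas lin_gen = lin_mul_ev lin_der_ev lin_mul_od lin_der_od

lemmas lin_gen_simps =
  lin_gen[THEN spoly.linear_add] lin_gen[THEN spoly.linear_diff]
  lin_gen[THEN spoly.linear_neg] lin_gen[THEN spoly.linear_0]
  lin_gen[THEN spoly.linear_scale]

lemmas lin_gen_sum = lin_gen[THEN spoly.linear_sum]

text \<open>The source of every sign below: one more odd variable below \<open>t\<close> flips the
  parity. The counted set is bounded by \<open>t\<close>, hence finite for any \<open>U\<close>, so
  the odd relations hold for all coefficient functions and not only for polynomials.\<close>

lemma osign_insert:
  assumes "s \<notin> U"
  shows "osign (insert s U) t = (if s < t then - osign U t else osign U t)"
proof (cases "s < t")
  case True
  then have "{u \<in> insert s U. u < t} = insert s {u \<in> U. u < t}" by auto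
  with assms True show ?thesis by (simp add: osign_def)
next
  case False
  then have "{u \<in> insert s U. u < t} = {u \<in> U. u < t}" by auto
  with False show ?thesis by (simp add: osign_def)
qed

lemma osign_remove:
  assumes "s \<in> U"
  shows "osign (U - {s}) t = (if s < t then - osign U t else osign U t)"
  using osign_insert[of s "U - {s}" t] assms by (auto simp: insert_absorb)

lemma osign_square: "osign U t * osign U t = 1"
  by (simp add: osign_def flip: power_mult_distrib)

lemma osign_square_left: "osign U t * (osign U t * c) = c"
  by (simp add: osign_square flip: mult.assoc)

section \<open>Relations of the Weyl-Clifford superalgebra\<close>

lemma mul_ev_mul_ev: "mul_ev e (mul_ev f p) = mul_ev f (mul_ev e p)"
  by (auto simp: mul_ev_def fun_eq_iff fun_upd_twist)

lemma der_ev_der_ev: "der_ev e (der_ev f p) = der_ev f (der_ev e p)"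
  by (auto simp: der_ev_def fun_eq_iff fun_upd_twist)

lemma der_ev_mul_ev: "der_ev e (mul_ev f p) = (if e = f then p else 0) + mul_ev f (der_ev e p)"
  by (auto simp: der_ev_def mul_ev_def fun_eq_iff fun_upd_twist algebra_simps)

lemma ev_od_commute:
  "mul_od t (mul_ev e p) = mul_ev e (mul_od t p)"
  "mul_od t (der_ev e p) = der_ev e (mul_od t p)"
  "der_od t (mul_ev e p) = mul_ev e (der_od t p)"
  "der_od t (der_ev e p) = der_ev e (der_od t p)"
  by (auto simp: mul_od_def mul_ev_def der_od_def der_ev_def fun_eq_iff)

lemma mul_od_mul_od: "mul_od s (mul_od t p) = - mul_od t (mul_od s p)"
  by (cases "s = t")
     (auto simp: mul_od_def fun_eq_iff osign_remove Diff_insert2[symmetric] insert_commute)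

lemma der_od_der_od: "der_od s (der_od t p) = - der_od t (der_od s p)"
  by (cases "s = t") (auto simp: der_od_def fun_eq_iff osign_insert insert_commute)

lemma der_od_mul_od: "der_od s (mul_od t p) = (if s = t then p else 0) - mul_od t (der_od s p)"
proof (cases "s = t")
  case True
  then show ?thesis
    by (auto simp: mul_od_def der_od_def fun_eq_iff osign_insert osign_remove osign_square_left insert_absorb)
next
  case False
  then have "insert s U - {t} = insert s (U - {t})" for U by auto
  with False show ?thesis
    by (auto simp: mul_od_def der_od_def fun_eq_iff osign_insert osign_remove)
qed

section \<open>The Laplacian, eta and the action\<close>

lemma Lap_eq: "Lap n m p =
    (\<Sum>i=1..n. der_ev i (der_ev (n+i) p)) + (\<Sum>r=1..m. der_od r (der_od (m+r) p))"
  by (simp add: Lap_def fun_eq_iff sum_fun_apply)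

lemma eta_eq: "eta n m p =
    (\<Sum>i=1..n. mul_ev i (mul_ev (n+i) p)) + (\<Sum>r=1..m. mul_od r (mul_od (m+r) p))"
  by (simp add: eta_def fun_eq_iff sum_fun_apply)

lemma lin_Lap: "lin (Lap n m)"
  by (rule linI)
     (simp_all add: Lap_eq lin_gen_simps sum.distrib spoly.scale_sum_right spoly.scale_right_distrib)

lemma lin_eta: "lin (eta n m)"
  by (rule linI)
     (simp_all add: eta_eq lin_gen_simps sum.distrib spoly.scale_sum_right spoly.scale_right_distrib)

lemmas lin_Lap_eta_simps =
  lin_Lap[THEN spoly.linear_add] lin_Lap[THEN spoly.linear_diff]
  lin_Lap[THEN spoly.linear_neg] lin_Lap[THEN spoly.linear_0] lin_Lap[THEN spoly.linear_scale]
  lin_eta[THEN spoly.linear_add] lin_eta[THEN spoly.linear_diff]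
  lin_eta[THEN spoly.linear_neg] lin_eta[THEN spoly.linear_0] lin_eta[THEN spoly.linear_scale]

text \<open>The commutator of the Laplacian with a variable is the derivation in the dual variable,
  since a single summand of the Laplacian fails to commute.\<close>

lemma Lap_x:
  assumes "i \<in> {1..n}"
  shows "Lap n m (mul_ev i p) = mul_ev i (Lap n m p) + der_ev (n+i) p"
proof -
  have "der_ev j (der_ev (n+j) (mul_ev i p)) =
      mul_ev i (der_ev j (der_ev (n+j) p)) + (if i = j then der_ev (n+i) p else 0)"
    if "j \<in> {1..n}" for j
    using that assms by (auto simp: der_ev_mul_ev lin_gen_simps)
  with assms show ?thesis
    by (simp add: Lap_eq lin_gen_simps lin_gen_sum sum.distrib ev_od_commute)
qed

lemma Lap_y:
  assumes "i \<in> {1..n}"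
  shows "Lap n m (mul_ev (n+i) p) = mul_ev (n+i) (Lap n m p) + der_ev i p"
proof -
  have "der_ev j (der_ev (n+j) (mul_ev (n+i) p)) =
      mul_ev (n+i) (der_ev j (der_ev (n+j) p)) + (if i = j then der_ev i p else 0)"
    if "j \<in> {1..n}" for j
    using that assms by (auto simp: der_ev_mul_ev lin_gen_simps)
  with assms show ?thesis
    by (simp add: Lap_eq lin_gen_simps lin_gen_sum sum.distrib ev_od_commute)
qed

text \<open>The minus sign, absent for the other three kinds of variable, arises because the inner
  derivation in vartheta_r has to pass theta_r before the outer one meets it.\<close>

lemma Lap_theta:
  assumes "r \<in> {1..m}"
  shows "Lap n m (mul_od r p) = mul_od r (Lap n m p) - der_od (m+r) p"
proof -
  have "der_od j (der_od (m+j) (mul_od r p)) =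
      mul_od r (der_od j (der_od (m+j) p)) + (if r = j then - der_od (m+r) p else 0)"
    if "j \<in> {1..m}" for j
    using that assms by (auto simp: der_od_mul_od lin_gen_simps)
  with assms show ?thesis
    by (simp add: Lap_eq lin_gen_simps lin_gen_sum sum.distrib ev_od_commute)
qed

lemma Lap_vartheta:
  assumes "r \<in> {1..m}"
  shows "Lap n m (mul_od (m+r) p) = mul_od (m+r) (Lap n m p) + der_od r p"
proof -
  have "der_od j (der_od (m+j) (mul_od (m+r) p)) =
      mul_od (m+r) (der_od j (der_od (m+j) p)) + (if r = j then der_od r p else 0)"
    if "j \<in> {1..m}" for j
    using that assms by (auto simp: der_od_mul_od lin_gen_simps)
  with assms show ?thesis
    by (simp add: Lap_eq lin_gen_simps lin_gen_sum sum.distrib ev_od_commute)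
qed

lemma Lap_der_ev: "Lap n m (der_ev e p) = der_ev e (Lap n m p)"
  by (simp add: Lap_eq lin_gen_simps lin_gen_sum ev_od_commute der_ev_der_ev[of _ e])

lemma Lap_der_od: "Lap n m (der_od t p) = der_od t (Lap n m p)"
  by (simp add: Lap_eq lin_gen_simps lin_gen_sum ev_od_commute der_od_der_od[of _ t])

lemma eta_x:
  assumes "i \<in> {1..n}"
  shows "der_ev i (eta n m p) = eta n m (der_ev i p) + mul_ev (n+i) p"
proof -
  have "der_ev i (mul_ev j (mul_ev (n+j) p)) =
      mul_ev j (mul_ev (n+j) (der_ev i p)) + (if i = j then mul_ev (n+i) p else 0)"
    if "j \<in> {1..n}" for j
    using that assms by (auto simp: der_ev_mul_ev lin_gen_simps)
  with assms show ?thesis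
    by (simp add: eta_eq lin_gen_simps lin_gen_sum sum.distrib ev_od_commute)
qed

lemma eta_y:
  assumes "i \<in> {1..n}"
  shows "der_ev (n+i) (eta n m p) = eta n m (der_ev (n+i) p) + mul_ev i p"
proof -
  have "der_ev (n+i) (mul_ev j (mul_ev (n+j) p)) =
      mul_ev j (mul_ev (n+j) (der_ev (n+i) p)) + (if i = j then mul_ev i p else 0)"
    if "j \<in> {1..n}" for j
    using that assms by (auto simp: der_ev_mul_ev lin_gen_simps)
  with assms show ?thesis
    by (simp add: eta_eq lin_gen_simps lin_gen_sum sum.distrib ev_od_commute)
qed

lemma eta_theta:
  assumes "r \<in> {1..m}"
  shows "der_od r (eta n m p) = eta n m (der_od r p) + mul_od (m+r) p"
proof -
  have "der_od r (mul_od j (mul_od (m+j) p)) =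
      mul_od j (mul_od (m+j) (der_od r p)) + (if r = j then mul_od (m+r) p else 0)"
    if "j \<in> {1..m}" for j
    using that assms by (auto simp: der_od_mul_od lin_gen_simps)
  with assms show ?thesis
    by (simp add: eta_eq lin_gen_simps lin_gen_sum sum.distrib ev_od_commute)
qed

lemma eta_vartheta:
  assumes "r \<in> {1..m}"
  shows "der_od (m+r) (eta n m p) = eta n m (der_od (m+r) p) - mul_od r p"
proof -
  have "der_od (m+r) (mul_od j (mul_od (m+j) p)) =
      mul_od j (mul_od (m+j) (der_od (m+r) p)) + (if r = j then - mul_od r p else 0)"
    if "j \<in> {1..m}" for j
    using that assms by (auto simp: der_od_mul_od lin_gen_simps)
  with assms show ?thesis
    by (simp add: eta_eq lin_gen_simps lin_gen_sum sum.distrib ev_od_commute)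
qed

lemma eta_mul_ev: "eta n m (mul_ev e p) = mul_ev e (eta n m p)"
  by (simp add: eta_eq lin_gen_simps lin_gen_sum ev_od_commute mul_ev_mul_ev[of _ e])

lemma eta_mul_od: "eta n m (mul_od t p) = mul_od t (eta n m p)"
  by (simp add: eta_eq lin_gen_simps lin_gen_sum ev_od_commute mul_od_mul_od[of _ t])

lemma padd_eq: "padd F G = (\<lambda>p. F p + G p)"
  by (simp add: padd_def fun_eq_iff)

lemma psub_eq: "psub F G = (\<lambda>p. F p - G p)"
  by (simp add: psub_def fun_eq_iff)

lemma osp_ops_cases [consumes 1, case_names xx tt xt tx xy yx vt tv xv yt]:
  assumes "T \<in> osp_ops n m"
  obtains
    i j where "i \<in> {1..n}" "j \<in> {1..n}"
      "T = (\<lambda>p. mul_ev i (der_ev j p) - mul_ev (n+j) (der_ev (n+i) p))"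
  | r s where "r \<in> {1..m}" "s \<in> {1..m}"
      "T = (\<lambda>p. mul_od r (der_od s p) - mul_od (m+s) (der_od (m+r) p))"
  | i r where "i \<in> {1..n}" "r \<in> {1..m}"
      "T = (\<lambda>p. mul_ev i (der_od r p) - mul_od (m+r) (der_ev (n+i) p))"
  | i r where "i \<in> {1..n}" "r \<in> {1..m}"
      "T = (\<lambda>p. mul_od r (der_ev i p) + mul_ev (n+i) (der_od (m+r) p))"
  | i j where "i \<in> {1..n}" "j \<in> {1..n}" "i < j"
      "T = (\<lambda>p. mul_ev i (der_ev (n+j) p) - mul_ev j (der_ev (n+i) p))"
  | i j where "i \<in> {1..n}" "j \<in> {1..n}" "i < j"
      "T = (\<lambda>p. mul_ev (n+i) (der_ev j p) - mul_ev (n+j) (der_ev i p))"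
  | r s where "r \<in> {1..m}" "s \<in> {1..m}" "r \<le> s"
      "T = (\<lambda>p. mul_od (m+r) (der_od s p) + mul_od (m+s) (der_od r p))"
  | r s where "r \<in> {1..m}" "s \<in> {1..m}" "r \<le> s"
      "T = (\<lambda>p. mul_od r (der_od (m+s) p) + mul_od s (der_od (m+r) p))"
  | i r where "i \<in> {1..n}" "r \<in> {1..m}"
      "T = (\<lambda>p. mul_ev i (der_od (m+r) p) + mul_od r (der_ev (n+i) p))"
  | i r where "i \<in> {1..n}" "r \<in> {1..m}"
      "T = (\<lambda>p. mul_ev (n+i) (der_od r p) - mul_od (m+r) (der_ev i p))"
  using assms unfolding osp_ops_def padd_eq psub_eq Un_iff mem_Collect_eq comp_def
  by (elim disjE exE conjE; simp only:) (rule that; simp)+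

lemma osp_op_in_osp_ops:
  "\<lbrakk>i \<in> {1..n}; j \<in> {1..n}\<rbrakk> \<Longrightarrow>
    (\<lambda>p. mul_ev i (der_ev j p) - mul_ev (n+j) (der_ev (n+i) p)) \<in> osp_ops n m"
  "\<lbrakk>r \<in> {1..m}; s \<in> {1..m}\<rbrakk> \<Longrightarrow>
    (\<lambda>p. mul_od r (der_od s p) - mul_od (m+s) (der_od (m+r) p)) \<in> osp_ops n m"
  "\<lbrakk>i \<in> {1..n}; r \<in> {1..m}\<rbrakk> \<Longrightarrow>
    (\<lambda>p. mul_ev i (der_od r p) - mul_od (m+r) (der_ev (n+i) p)) \<in> osp_ops n m"
  "\<lbrakk>i \<in> {1..n}; r \<in> {1..m}\<rbrakk> \<Longrightarrow>
    (\<lambda>p. mul_od r (der_ev i p) + mul_ev (n+i) (der_od (m+r) p)) \<in> osp_ops n m"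
  "\<lbrakk>i \<in> {1..n}; j \<in> {1..n}; i < j\<rbrakk> \<Longrightarrow>
    (\<lambda>p. mul_ev i (der_ev (n+j) p) - mul_ev j (der_ev (n+i) p)) \<in> osp_ops n m"
  "\<lbrakk>i \<in> {1..n}; j \<in> {1..n}; i < j\<rbrakk> \<Longrightarrow>
    (\<lambda>p. mul_ev (n+i) (der_ev j p) - mul_ev (n+j) (der_ev i p)) \<in> osp_ops n m"
  "\<lbrakk>r \<in> {1..m}; s \<in> {1..m}; r \<le> s\<rbrakk> \<Longrightarrow>
    (\<lambda>p. mul_od (m+r) (der_od s p) + mul_od (m+s) (der_od r p)) \<in> osp_ops n m"
  "\<lbrakk>r \<in> {1..m}; s \<in> {1..m}; r \<le> s\<rbrakk> \<Longrightarrow>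
    (\<lambda>p. mul_od r (der_od (m+s) p) + mul_od s (der_od (m+r) p)) \<in> osp_ops n m"
  "\<lbrakk>i \<in> {1..n}; r \<in> {1..m}\<rbrakk> \<Longrightarrow>
    (\<lambda>p. mul_ev i (der_od (m+r) p) + mul_od r (der_ev (n+i) p)) \<in> osp_ops n m"
  "\<lbrakk>i \<in> {1..n}; r \<in> {1..m}\<rbrakk> \<Longrightarrow>
    (\<lambda>p. mul_ev (n+i) (der_od r p) - mul_od (m+r) (der_ev i p)) \<in> osp_ops n m"
  unfolding osp_ops_def padd_eq psub_eq Un_iff mem_Collect_eq comp_def atLeastAtMost_iff
  by blast+

lemma lin_osp_op: "T \<in> osp_ops n m \<Longrightarrow> lin T"
  by (erule osp_ops_cases; rule linI)
     (simp_all add: lin_gen_simps spoly.scale_right_distrib spoly.scale_right_diff_distrib)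

text \<open>Derivations commute with the Laplacian, so each of the two summands of \<open>T\<close>
  contributes one product of two derivations as commutator. The products agree up to order, and the
  sign between the summands is the one that makes them cancel.\<close>

lemma Lap_osp_op:
  assumes "T \<in> osp_ops n m"
  shows "Lap n m (T p) = T (Lap n m p)"
  using assms
proof (cases rule: osp_ops_cases)
  case (tt r s)
  then show ?thesis
    by (simp add: Lap_theta Lap_vartheta Lap_der_od lin_Lap_eta_simps der_od_der_od[of "m+r" s])
next
  case (vt r s)
  then show ?thesis
    by (simp add: Lap_theta Lap_vartheta Lap_der_od lin_Lap_eta_simps der_od_der_od[of r s])
next
  case (tv r s)
  then show ?thesis
    by (simp add: Lap_theta Lap_vartheta Lap_der_od lin_Lap_eta_simps der_od_der_od[of "m+r" "m+s"])
qed (simp_all add: Lap_x Lap_y Lap_theta Lap_vartheta Lap_der_ev Lap_der_od lin_Lap_eta_simps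
      ev_od_commute(4) der_ev_der_ev)

text \<open>Dual to the case of the Laplacian: multiplications commute with \<open>eta\<close>, and
  the two leftover products of two variables cancel.\<close>

lemma eta_osp_op:
  assumes "T \<in> osp_ops n m"
  shows "eta n m (T p) = T (eta n m p)"
  using assms
proof (cases rule: osp_ops_cases)
  case (tt r s)
  then show ?thesis
    by (simp add: eta_theta eta_vartheta eta_mul_od lin_Lap_eta_simps lin_gen_simps mul_od_mul_od[of r "m+s"])
next
  case (vt r s)
  then show ?thesis
    by (simp add: eta_theta eta_vartheta eta_mul_od lin_Lap_eta_simps lin_gen_simps mul_od_mul_od[of "m+r" "m+s"])
next
  case (tv r s)
  then show ?thesis
    by (simp add: eta_theta eta_vartheta eta_mul_od lin_Lap_eta_simps lin_gen_simps mul_od_mul_od[of r s])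
qed (simp_all add: eta_x eta_y eta_theta eta_vartheta eta_mul_ev eta_mul_od lin_Lap_eta_simps lin_gen_simps
      ev_od_commute(1) mul_ev_mul_ev)

section \<open>Degrees and the harmonic decomposition\<close>

text \<open>Stated additively so that raising and lowering an exponent both follow from it without
  truncated subtraction.\<close>

lemma mdeg_upd:
  assumes "e \<in> {1..2*n}"
  shows "mdeg n (a(e := v), U) + a e = mdeg n (a, U) + v"
proof -
  have "(\<Sum>i\<in>{1..2*n} - {e}. (a(e := v)) i) = (\<Sum>i\<in>{1..2*n} - {e}. a i)"
    by (rule sum.cong) auto
  moreover have "sum g {1..2*n} = g e + sum g ({1..2*n} - {e})" for g :: "nat \<Rightarrow> nat"
    using assms by (intro sum.remove) auto
  ultimately show ?thesis
    by (simp add: mdeg_def del: One_nat_def)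
qed

lemma mdeg_insert:
  assumes "U \<subseteq> {1..2*m}" "t \<notin> U"
  shows "mdeg n (a, insert t U) = Suc (mdeg n (a, U))"
  using assms finite_subset[OF assms(1)] by (simp add: mdeg_def)

lemma valid_mon_upd:
  "valid_mon n m (a(e := v), U) \<Longrightarrow> e \<in> {1..2*n} \<Longrightarrow> valid_mon n m (a, U)"
  unfolding valid_mon_def by (metis fst_conv fun_upd_other snd_conv)

lemma AkI: "(\<And>a U. p (a, U) \<noteq> 0 \<Longrightarrow> valid_mon n m (a, U) \<and> mdeg n (a, U) = k) \<Longrightarrow> p \<in> Ak n m k"
  by (auto simp: Ak_def)

lemma AkD: "p \<in> Ak n m k \<Longrightarrow> p (a, U) \<noteq> 0 \<Longrightarrow> valid_mon n m (a, U) \<and> mdeg n (a, U) = k"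
  by (auto simp: Ak_def)

lemma Ak_0 [simp]: "0 \<in> Ak n m k"
  by (auto simp: Ak_def)

lemma Ak_add: "p \<in> Ak n m k \<Longrightarrow> q \<in> Ak n m k \<Longrightarrow> p + q \<in> Ak n m k"
  unfolding Ak_def by force

lemma Ak_smul: "p \<in> Ak n m k \<Longrightarrow> smul c p \<in> Ak n m k"
  by (auto simp: Ak_def)

lemma Ak_diff: "p \<in> Ak n m k \<Longrightarrow> q \<in> Ak n m k \<Longrightarrow> p - q \<in> Ak n m k"
  unfolding Ak_def by force

lemma Ak_sum: "(\<And>i. i \<in> I \<Longrightarrow> f i \<in> Ak n m k) \<Longrightarrow> (\<Sum>i\<in>I. f i) \<in> Ak n m k"
  by (induction I rule: infinite_finite_induct) (auto intro: Ak_add)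

lemma Ak_mul_ev:
  assumes "p \<in> Ak n m k" "e \<in> {1..2*n}"
  shows "mul_ev e p \<in> Ak n m (Suc k)"
proof (rule AkI)
  fix a U assume "mul_ev e p (a, U) \<noteq> 0"
  then have "a e > 0" "p (a(e := a e - 1), U) \<noteq> 0"
    by (auto simp: mul_ev_def split: if_splits)
  with AkD[OF assms(1)] valid_mon_upd[OF _ assms(2)] mdeg_upd[OF assms(2), of a "a e - 1" U]
  show "valid_mon n m (a, U) \<and> mdeg n (a, U) = Suc k" by fastforce
qed

lemma Ak_der_ev:
  assumes "p \<in> Ak n m (Suc k)"
  shows "der_ev e p \<in> Ak n m k"
proof (rule AkI)
  fix a U assume "der_ev e p (a, U) \<noteq> 0"
  then have "p (a(e := a e + 1), U) \<noteq> 0"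
    by (auto simp: der_ev_def)
  with AkD[OF assms] have *: "valid_mon n m (a(e := a e + 1), U)" "mdeg n (a(e := a e + 1), U) = Suc k"
    by blast+
  then have e: "e \<in> {1..2*n}" by (auto simp: valid_mon_def)
  with * valid_mon_upd[OF *(1) e] mdeg_upd[OF e, of a "a e + 1" U]
  show "valid_mon n m (a, U) \<and> mdeg n (a, U) = k" by simp
qed

lemma der_ev_Ak_0:
  assumes "p \<in> Ak n m 0"
  shows "der_ev e p = 0"
proof (rule ccontr)
  assume "der_ev e p \<noteq> 0"
  then obtain a U where "der_ev e p (a, U) \<noteq> 0" by (auto simp: fun_eq_iff)
  then have "p (a(e := a e + 1), U) \<noteq> 0"
    by (auto simp: der_ev_def)
  with AkD[OF assms] have *: "valid_mon n m (a(e := a e + 1), U)" "mdeg n (a(e := a e + 1), U) = 0"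
    by blast+
  then have e: "e \<in> {1..2*n}" by (auto simp: valid_mon_def)
  with * mdeg_upd[OF e, of a "a e + 1" U] show False by simp
qed

lemma Ak_mul_od:
  assumes "p \<in> Ak n m k" "t \<in> {1..2*m}"
  shows "mul_od t p \<in> Ak n m (Suc k)"
proof (rule AkI)
  fix a U assume "mul_od t p (a, U) \<noteq> 0"
  then have t: "t \<in> U" and "p (a, U - {t}) \<noteq> 0"
    by (auto simp: mul_od_def split: if_splits)
  with AkD[OF assms(1)] have *: "valid_mon n m (a, U - {t})" "mdeg n (a, U - {t}) = k" by blast+
  then have "U - {t} \<subseteq> {1..2*m}" by (simp add: valid_mon_def)
  from mdeg_insert[OF this, of t n a] * t assms(2)
  show "valid_mon n m (a, U) \<and> mdeg n (a, U) = Suc k"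
    by (auto simp: insert_absorb valid_mon_def)
qed

lemma Ak_der_od:
  assumes "p \<in> Ak n m (Suc k)"
  shows "der_od t p \<in> Ak n m k"
proof (rule AkI)
  fix a U assume "der_od t p (a, U) \<noteq> 0"
  then have t: "t \<notin> U" and "p (a, insert t U) \<noteq> 0"
    by (auto simp: der_od_def split: if_splits)
  with AkD[OF assms(1)] have *: "valid_mon n m (a, insert t U)" "mdeg n (a, insert t U) = Suc k" by blast+
  then have "U \<subseteq> {1..2*m}" by (simp add: valid_mon_def)
  from mdeg_insert[OF this t, of n a] *
  show "valid_mon n m (a, U) \<and> mdeg n (a, U) = k"
    by (auto simp: valid_mon_def)
qed

lemma der_od_Ak_0:
  assumes "p \<in> Ak n m 0"
  shows "der_od t p = 0"
proof (rule ccontr)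
  assume "der_od t p \<noteq> 0"
  then obtain a U where "der_od t p (a, U) \<noteq> 0" by (auto simp: fun_eq_iff)
  then have t: "t \<notin> U" and "p (a, insert t U) \<noteq> 0"
    by (auto simp: der_od_def split: if_splits)
  with AkD[OF assms(1)] have *: "valid_mon n m (a, insert t U)" "mdeg n (a, insert t U) = 0" by blast+
  then have "U \<subseteq> {1..2*m}" by (simp add: valid_mon_def)
  from mdeg_insert[OF this t, of n a] * show False by simp
qed

lemma Ak_mul_der:
  assumes "p \<in> Ak n m k"
  shows "e \<in> {1..2*n} \<Longrightarrow> mul_ev e (der_ev f p) \<in> Ak n m k"
    "e \<in> {1..2*n} \<Longrightarrow> mul_ev e (der_od t p) \<in> Ak n m k"
    "s \<in> {1..2*m} \<Longrightarrow> mul_od s (der_ev f p) \<in> Ak n m k"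
    "s \<in> {1..2*m} \<Longrightarrow> mul_od s (der_od t p) \<in> Ak n m k"
  using assms
  by (cases k; simp add: der_ev_Ak_0 der_od_Ak_0 lin_gen_simps Ak_mul_ev Ak_mul_od Ak_der_ev Ak_der_od)+

lemma Ak_osp_op:
  assumes "T \<in> osp_ops n m" "p \<in> Ak n m k"
  shows "T p \<in> Ak n m k"
  using assms(1) by (cases rule: osp_ops_cases) (auto intro!: Ak_add Ak_diff Ak_mul_der assms(2))

lemma Ak_eta: "p \<in> Ak n m k \<Longrightarrow> eta n m p \<in> Ak n m (Suc (Suc k))"
  unfolding eta_eq by (intro Ak_add Ak_sum Ak_mul_ev Ak_mul_od) auto

lemma Ak_eta_pow: "p \<in> Ak n m k \<Longrightarrow> (eta n m ^^ i) p \<in> Ak n m (k + 2*i)"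
  by (induction i) (auto dest: Ak_eta)

lemma Ak_Lap: "p \<in> Ak n m (Suc (Suc k)) \<Longrightarrow> Lap n m p \<in> Ak n m k"
  unfolding Lap_eq by (intro Ak_add Ak_sum Ak_der_ev Ak_der_od)

lemma Lap_Ak_le_1:
  assumes "p \<in> Ak n m k" "k < 2"
  shows "Lap n m p = 0"
proof (cases k)
  case 0
  with assms show ?thesis by (simp add: Lap_eq der_ev_Ak_0[of _ n m] der_od_Ak_0[of _ n m] lin_gen_simps)
next
  case (Suc l)
  with assms have "p \<in> Ak n m (Suc 0)" by simp
  then have "der_ev e p \<in> Ak n m 0" "der_od t p \<in> Ak n m 0" for e t
    by (auto intro: Ak_der_ev Ak_der_od)
  then show ?thesis by (simp add: Lap_eq der_ev_Ak_0[of _ n m] der_od_Ak_0[of _ n m])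
qed

lemma Hk_iff: "p \<in> Hk n m k \<longleftrightarrow> p \<in> Ak n m k \<and> Lap n m p = 0"
  by (simp add: Hk_def zero_fun_def)

lemma submodule_iff: "submodule ops W \<longleftrightarrow> spoly.subspace W \<and> (\<forall>T\<in>ops. \<forall>f\<in>W. T f \<in> W)"
  unfolding submodule_def spoly.subspace_def plus_fun_def zero_fun_def smul_def by blast

lemma submodule_Hk: "submodule (osp_ops n m) (Hk n m k)"
  unfolding submodule_iff spoly.subspace_def Hk_iff
  by (auto simp: Hk_iff lin_Lap_eta_simps Ak_add Ak_smul Ak_osp_op Lap_osp_op
      lin_osp_op[THEN spoly.linear_0])

section \<open>The Euler operator and the sl(2)-relation\<close>

lemma sum_halves: "(\<Sum>i=1..N. f i) + (\<Sum>i=1..N. f (N+i)) = (\<Sum>i\<in>{1..2*N}. f i)"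
  for f :: "nat \<Rightarrow> 'a::comm_monoid_add"
proof -
  have "(\<Sum>i=1..N. f (N+i)) = (\<Sum>i=N+1..2*N. f i)"
    by (rule sum.reindex_bij_witness[of _ "\<lambda>i. i - N" "\<lambda>i. N + i"]) auto
  moreover have "{1..2*N} = {1..N} \<union> {N+1..2*N}" by auto
  ultimately show ?thesis by (simp add: sum.union_disjoint)
qed

text \<open>All these operators are diagonal on monomials: an even one has the exponent as
  eigenvalue, an odd one has 1 or 0 according to membership, the two signs \<open>osign\<close>
  cancelling.\<close>

lemma Euler:
  assumes "p \<in> Ak n m k"
  shows "(\<Sum>e\<in>{1..2*n}. mul_ev e (der_ev e p)) + (\<Sum>t\<in>{1..2*m}. mul_od t (der_od t p)) = smul (of_nat k) p"
proof
  fix \<mu> :: smon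
  obtain a U where \<mu>: "\<mu> = (a, U)" by (cases \<mu>)
  have ev: "mul_ev e (der_ev e p) (a, U) = of_nat (a e) * p (a, U)" for e
    by (simp add: mul_ev_def der_ev_def)
  have od: "mul_od t (der_od t p) (a, U) = (if t \<in> U then p (a, U) else 0)" for t
    by (simp add: mul_od_def der_od_def osign_remove osign_square_left insert_absorb)
  have "(\<Sum>e\<in>{1..2*n}. mul_ev e (der_ev e p) (a, U)) + (\<Sum>t\<in>{1..2*m}. mul_od t (der_od t p) (a, U))
      = of_nat ((\<Sum>e\<in>{1..2*n}. a e) + card ({1..2*m} \<inter> U)) * p (a, U)"
    unfolding ev od by (simp add: sum.If_cases distrib_right flip: sum_distrib_right)
  also have "\<dots> = of_nat k * p (a, U)"
  proof (cases "p (a, U) = 0")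
    case False
    then have "valid_mon n m (a, U)" and *: "mdeg n (a, U) = k" using AkD[OF assms] by blast+
    then have "{1..2*m} \<inter> U = U" by (auto simp: valid_mon_def)
    with * show ?thesis by (simp add: mdeg_def)
  qed simp
  finally show "((\<Sum>e\<in>{1..2*n}. mul_ev e (der_ev e p)) + (\<Sum>t\<in>{1..2*m}. mul_od t (der_od t p))) \<mu> =
      smul (of_nat k) p \<mu>"
    by (simp add: \<mu> sum_fun_apply)
qed

text \<open>The degree k comes from the Euler operator. The rest is half the superdimension:
  reordering adds one copy of \<open>p\<close> for each even pair and removes one for each odd
  pair.\<close>

lemma Lap_eta:
  assumes "p \<in> Ak n m k"
  shows "Lap n m (eta n m p) = eta n m (Lap n m p) + smul (of_nat n - of_nat m + of_nat k) p"
proof -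
  have even: "Lap n m (mul_ev i (mul_ev (n+i) p)) = mul_ev i (mul_ev (n+i) (Lap n m p))
      + (mul_ev i (der_ev i p) + mul_ev (n+i) (der_ev (n+i) p)) + p" if "i \<in> {1..n}" for i
    using that by (simp add: Lap_x Lap_y lin_gen_simps der_ev_mul_ev)
  have odd: "Lap n m (mul_od r (mul_od (m+r) p)) = mul_od r (mul_od (m+r) (Lap n m p))
      + (mul_od r (der_od r p) + mul_od (m+r) (der_od (m+r) p)) - p" if "r \<in> {1..m}" for r
    using that by (simp add: Lap_theta Lap_vartheta lin_gen_simps der_od_mul_od)
  have const: "(\<Sum>i=1..N. p) = smul (of_nat N) p" for N
    by (simp add: fun_eq_iff sum_fun_apply)
  have "Lap n m (eta n m p) = (\<Sum>i=1..n. Lap n m (mul_ev i (mul_ev (n+i) p)))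
      + (\<Sum>r=1..m. Lap n m (mul_od r (mul_od (m+r) p)))"
    by (simp add: eta_eq lin_Lap[THEN spoly.linear_sum] lin_Lap_eta_simps)
  also have "\<dots> = eta n m (Lap n m p)
      + ((\<Sum>e\<in>{1..2*n}. mul_ev e (der_ev e p)) + (\<Sum>t\<in>{1..2*m}. mul_od t (der_od t p)))
      + (\<Sum>i=1..n. p) - (\<Sum>r=1..m. p)"
    by (simp only: even odd sum.distrib sum_subtractf eta_eq flip: sum_halves cong: sum.cong)
       (simp add: algebra_simps)
  also have "\<dots> = eta n m (Lap n m p) + smul (of_nat n - of_nat m + of_nat k) p"
    unfolding Euler[OF assms] const by (simp add: fun_eq_iff algebra_simps)
  finally show ?thesis .
qed

text \<open>Passing the factors \<open>eta\<close> one at a time contributes n - m + l + 2j for j =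
  0, ..., i, an arithmetic progression with the stated sum. The constant is kept as an integer so
  that its vanishing can be decided by integer arithmetic.\<close>

lemma Lap_eta_pow:
  assumes "h \<in> Hk n m l"
  shows "Lap n m ((eta n m ^^ Suc i) h) =
    smul (of_int (int (Suc i) * (int n - int m + int l + int i))) ((eta n m ^^ i) h)"
proof (induction i)
  case 0
  from assms show ?case by (simp add: Hk_iff Lap_eta[of h n m l] lin_Lap_eta_simps)
next
  case (Suc i)
  have "(eta n m ^^ Suc i) h \<in> Ak n m (l + 2 * Suc i)"
    using assms Ak_eta_pow by (auto simp only: Hk_iff)
  from Lap_eta[OF this] show ?case
    unfolding funpow.simps(2)[of "Suc i"] comp_def Suc
    by (simp add: lin_Lap_eta_simps fun_eq_iff algebra_simps)
qed

section \<open>Harmonic decomposition for k at most M\<close>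

lemma lin_eta_pow: "lin (eta n m ^^ i)"
proof (induction i)
  case 0
  show ?case by (intro linI) (simp_all add: fun_eq_iff)
next
  case (Suc i)
  show ?case
    by (intro linI) (simp_all only: funpow.simps comp_apply spoly.linear_add[OF Suc] spoly.linear_scale[OF Suc] lin_Lap_eta_simps)
qed

text \<open>With l = k - 2(i+1) the second factor is n - m + k - 2 - i, which the bound on k makes
  at most -1 - i.\<close>

lemma Lap_eta_pow_factor_nonzero:
  assumes "int k \<le> int m + 1 - int n" "2 * Suc i \<le> k"
  shows "(of_int (int (Suc i) * (int n - int m + int (k - 2 * Suc i) + int i)) :: complex) \<noteq> 0"
proof -
  have "int n - int m + int (k - 2 * Suc i) + int i < 0"
    using assms(1) of_nat_diff[OF assms(2), where 'a = int] by simp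
  then show ?thesis unfolding of_int_eq_0_iff mult_eq_0_iff by linarith
qed

lemma Hk_smul: "h \<in> Hk n m l \<Longrightarrow> smul c h \<in> Hk n m l"
  by (simp add: Hk_iff Ak_smul lin_Lap_eta_simps)

text \<open>A preimage of \<open>Lap n m f\<close> under the Laplacian can be written down from the
  decomposition one step lower, because the Laplacian acts on each summand by a nonzero constant.
  The difference of \<open>f\<close> and this preimage is the harmonic component.\<close>

lemma harmonic_decomposition_exists:
  assumes "int k \<le> int m + 1 - int n" "f \<in> Ak n m k"
  shows "\<exists>h. (\<forall>i\<le>k div 2. h i \<in> Hk n m (k - 2*i)) \<and> f = (\<Sum>i\<le>k div 2. (eta n m ^^ i) (h i))"
  using assms
proof (induction k arbitrary: f rule: less_induct)
  case (less k)
  show ?case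
  proof (cases "k < 2")
    case True
    with less.prems(2) have "f \<in> Hk n m k" by (simp add: Hk_iff Lap_Ak_le_1)
    with True show ?thesis by (intro exI[of _ "\<lambda>_. f"]) simp
  next
    case False
    then obtain k' where k: "k = Suc (Suc k')" by (metis add_2_eq_Suc le_Suc_ex not_le)
    define c :: "nat \<Rightarrow> complex" where
      "c i = of_int (int (Suc i) * (int n - int m + int (k - 2 * Suc i) + int i))" for i
    have c: "c i \<noteq> 0" if "i \<le> k' div 2" for i
      unfolding c_def using that k by (intro Lap_eta_pow_factor_nonzero less.prems(1)) auto
    have "Lap n m f \<in> Ak n m k'" using less.prems(2) k by (simp add: Ak_Lap)
    then obtain g where g: "\<And>i. i \<le> k' div 2 \<Longrightarrow> g i \<in> Hk n m (k' - 2*i)"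
        and Lf: "Lap n m f = (\<Sum>i\<le>k' div 2. (eta n m ^^ i) (g i))"
      using less.IH[of k' "Lap n m f"] less.prems(1) k by auto
    \<comment> \<open>Division by \<open>c i\<close> cancels the constant produced when the
      Laplacian removes one factor \<open>eta\<close> from \<open>eta^(i+1)\<close>.\<close>
    define h where "h i = smul (1 / c i) (g i)" for i
    have h: "h i \<in> Hk n m (k - 2 * Suc i)" if "i \<le> k' div 2" for i
      using g[OF that] k by (simp add: h_def Hk_smul)
    define f' where "f' = (\<Sum>i\<le>k' div 2. (eta n m ^^ Suc i) (h i))"
    have "Lap n m ((eta n m ^^ Suc i) (h i)) = (eta n m ^^ i) (g i)" if "i \<le> k' div 2" for i
      unfolding Lap_eta_pow[OF h[OF that]] c_def[symmetric] unfolding h_def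
      using c[OF that] by (simp add: spoly.linear_scale[OF lin_eta_pow])
    then have "Lap n m f' = Lap n m f"
      by (simp add: f'_def Lf lin_Lap[THEN spoly.linear_sum] del: funpow.simps)
    moreover have "f' \<in> Ak n m k"
      unfolding f'_def
    proof (rule Ak_sum)
      fix i assume "i \<in> {..k' div 2}"
      then have "i \<le> k' div 2" by simp
      with h have "(eta n m ^^ Suc i) (h i) \<in> Ak n m (k - 2 * Suc i + 2 * Suc i)"
        by (blast intro: Ak_eta_pow Hk_iff[THEN iffD1, THEN conjunct1])
      moreover have "k - 2 * Suc i + 2 * Suc i = k" using \<open>i \<le> k' div 2\<close> k by (intro le_add_diff_inverse2) auto
      ultimately show "(eta n m ^^ Suc i) (h i) \<in> Ak n m k" by metis
    qed
    ultimately have "f - f' \<in> Hk n m k"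
      using less.prems(2) by (simp add: Hk_iff lin_Lap_eta_simps Ak_diff)
    moreover have "k div 2 = Suc (k' div 2)" using k by simp
    ultimately show ?thesis
      using h
      \<comment> \<open>The components of the preimage move up by one index, which frees index 0 for
        the harmonic remainder.\<close>
      by (intro exI[of _ "case_nat (f - f') h"])
         (auto simp: f'_def sum.atMost_Suc_shift split: nat.split simp del: sum.atMost_Suc funpow.simps(2))
  qed
qed

lemma harmonic_decomposition_unique:
  assumes "int k \<le> int m + 1 - int n"
    and "\<And>i. i \<le> k div 2 \<Longrightarrow> h i \<in> Hk n m (k - 2*i)"
    and "(\<Sum>i\<le>k div 2. (eta n m ^^ i) (h i)) = 0"
    and "i \<le> k div 2"
  shows "(eta n m ^^ i) (h i) = 0"
  using assms
proof (induction k arbitrary: h i rule: less_induct)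
  case (less k)
  show ?case
  proof (cases "k < 2")
    case True
    with less.prems show ?thesis by simp
  next
    case False
    then obtain k' where k: "k = Suc (Suc k')" by (metis add_2_eq_Suc le_Suc_ex not_le)
    define c :: "nat \<Rightarrow> complex" where
      "c i = of_int (int (Suc i) * (int n - int m + int (k - 2 * Suc i) + int i))" for i
    have c: "c i \<noteq> 0" if "i \<le> k' div 2" for i
      unfolding c_def using that k by (intro Lap_eta_pow_factor_nonzero less.prems(1)) auto
    have h: "h (Suc i) \<in> Hk n m (k - 2 * Suc i)" if "i \<le> k' div 2" for i
      using less.prems(2)[of "Suc i"] that k by simp
    have kd: "k div 2 = Suc (k' div 2)" using k by simp
    have sum: "h 0 + (\<Sum>i\<le>k' div 2. (eta n m ^^ Suc i) (h (Suc i))) = 0"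
      using less.prems(3) unfolding kd sum.atMost_Suc_shift by (simp only: funpow_0)
    have "Lap n m ((eta n m ^^ Suc i) (h (Suc i))) = (eta n m ^^ i) (smul (c i) (h (Suc i)))"
      if "i \<le> k' div 2" for i
      unfolding Lap_eta_pow[OF h[OF that]] c_def
      by (simp only: spoly.linear_scale[OF lin_eta_pow])
    moreover have "Lap n m (h 0) = 0" using less.prems(2)[of 0] by (simp add: Hk_iff)
    ultimately have 0: "(\<Sum>i\<le>k' div 2. (eta n m ^^ i) (smul (c i) (h (Suc i)))) = 0"
      using arg_cong[OF sum, of "Lap n m"]
      by (simp add: lin_Lap_eta_simps lin_Lap[THEN spoly.linear_sum] del: funpow.simps)
    have "(eta n m ^^ j) (smul (c j) (h (Suc j))) = 0" if "j \<le> k' div 2" for j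
    proof (rule less.IH[OF _ _ _ 0 that])
      show "smul (c i) (h (Suc i)) \<in> Hk n m (k' - 2 * i)" if "i \<le> k' div 2" for i
        using h[OF that] k by (simp add: Hk_smul)
    qed (use k less.prems(1) in auto)
    then have "(eta n m ^^ j) (h (Suc j)) = 0" if "j \<le> k' div 2" for j
      using c that by (simp add: spoly.linear_scale[OF lin_eta_pow])
    then have Suc: "(eta n m ^^ Suc j) (h (Suc j)) = 0" if "j \<le> k' div 2" for j
      using that by (simp add: lin_Lap_eta_simps)
    with sum have "h 0 = 0" by (simp del: funpow.simps)
    with Suc less.prems(4) k show ?thesis
      by (cases i) (simp_all del: funpow.simps(2))
  qed
qed

text \<open>Injectivity of powers of \<open>eta\<close>, needed to carry irreducibility over to the
  summands. The Laplacian strips one factor at the cost of a nonzero constant; k drops by 2 along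
  with i, so that the degree of \<open>h\<close> stays fixed.\<close>

lemma eta_pow_eq_0D:
  assumes "int k \<le> int m + 1 - int n" "2 * i \<le> k" "h \<in> Hk n m (k - 2*i)" "(eta n m ^^ i) h = 0"
  shows "h = 0"
  using assms
proof (induction i arbitrary: k)
  case (Suc i)
  have "smul (of_int (int (Suc i) * (int n - int m + int (k - 2 * Suc i) + int i)))
      ((eta n m ^^ i) h) = 0"
    using Lap_eta_pow[OF Suc.prems(3), of i] Suc.prems(4) by (simp only: lin_Lap_eta_simps)
  then have "(eta n m ^^ i) h = 0"
    using Lap_eta_pow_factor_nonzero[OF Suc.prems(1,2)] by (simp only: spoly.scale_eq_0_iff) blast
  moreover have "k - 2 * Suc i = (k - 2) - 2 * i" by simp
  ultimately show ?case using Suc.IH[of "k - 2"] Suc.prems by auto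
qed simp

section \<open>The invariant form\<close>

definition Mon :: "nat \<Rightarrow> nat \<Rightarrow> nat \<Rightarrow> smon set" where
  "Mon n m k = {\<mu>. valid_mon n m \<mu> \<and> mdeg n \<mu> = k}"

lemma finite_Mon: "finite (Mon n m k)"
proof -
  have "Mon n m k \<subseteq> {a. \<forall>e. (e \<in> {1..2*n} \<longrightarrow> a e \<in> {..k}) \<and> (e \<notin> {1..2*n} \<longrightarrow> a e = 0)} \<times> Pow {1..2*m}"
  proof
    fix \<mu> assume "\<mu> \<in> Mon n m k"
    then have v: "valid_mon n m \<mu>" and d: "mdeg n \<mu> = k" by (auto simp: Mon_def)
    have "fst \<mu> e \<le> k" if "e \<in> {1..2*n}" for e
      using member_le_sum[of e "{1..2*n}" "fst \<mu>"] that d by (simp add: mdeg_def)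
    with v show "\<mu> \<in> {a. \<forall>e. (e \<in> {1..2*n} \<longrightarrow> a e \<in> {..k}) \<and> (e \<notin> {1..2*n} \<longrightarrow> a e = 0)} \<times> Pow {1..2*m}"
      by (cases \<mu>) (auto simp: valid_mon_def)
  qed
  then show ?thesis
    by (rule finite_subset) (intro finite_cartesian_product finite_set_of_finite_funs; simp)
qed

lemma Mon_upd:
  assumes "e \<in> {1..2*n}"
  shows "(a(e := Suc (a e)), U) \<in> Mon n m (Suc k) \<longleftrightarrow> (a, U) \<in> Mon n m k"
proof -
  have "valid_mon n m (a(e := Suc (a e)), U) \<longleftrightarrow> valid_mon n m (a, U)"
    using assms by (auto simp: valid_mon_def)
  with mdeg_upd[OF assms, of a "Suc (a e)" U] show ?thesis by (auto simp: Mon_def)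
qed

lemma Mon_insert:
  assumes "t \<in> {1..2*m}" "t \<notin> U"
  shows "(a, insert t U) \<in> Mon n m (Suc k) \<longleftrightarrow> (a, U) \<in> Mon n m k"
  using assms mdeg_insert[of U m t n a] by (auto simp: Mon_def valid_mon_def)

text \<open>The form takes this value on a monomial paired with itself, as in the Fischer form:
  differentiating the power a+1 of an even variable costs the factor a+1, whence the factorials. The
  sign counts the variables vartheta.\<close>

definition wt :: "nat \<Rightarrow> nat \<Rightarrow> smon \<Rightarrow> complex" where
  "wt n m \<mu> = (\<Prod>e\<in>{1..2*n}. fact (fst \<mu> e)) * (-1) ^ card (snd \<mu> \<inter> {m+1..2*m})"

definition od_sign :: "nat \<Rightarrow> nat \<Rightarrow> complex" where
  "od_sign m t = (if m < t then - 1 else 1)"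

lemma wt_upd:
  assumes "e \<in> {1..2*n}"
  shows "wt n m (a(e := Suc (a e)), U) = of_nat (Suc (a e)) * wt n m (a, U)"
proof -
  have "(\<Prod>i\<in>{1..2*n} - {e}. fact ((a(e := Suc (a e))) i)) = (\<Prod>i\<in>{1..2*n} - {e}. fact (a i) :: complex)"
    by (rule prod.cong) auto
  moreover have "prod g {1..2*n} = g e * prod g ({1..2*n} - {e})" for g :: "nat \<Rightarrow> complex"
    using assms by (intro prod.remove) auto
  ultimately show ?thesis
    by (simp add: wt_def del: One_nat_def of_nat_Suc)
qed

lemma wt_insert:
  assumes "t \<in> {1..2*m}" "t \<notin> U"
  shows "wt n m (a, insert t U) = od_sign m t * wt n m (a, U)"
  using assms by (auto simp: wt_def od_sign_def Int_insert_left)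

definition form :: "nat \<Rightarrow> nat \<Rightarrow> nat \<Rightarrow> spoly \<Rightarrow> spoly \<Rightarrow> complex" where
  "form n m k p q = (\<Sum>\<mu>\<in>Mon n m k. wt n m \<mu> * (p \<mu> * q \<mu>))"

lemma form_sym: "form n m k p q = form n m k q p"
  by (simp add: form_def mult.commute)

lemma form_add_right: "form n m k p (q + q') = form n m k p q + form n m k p q'"
  by (simp add: form_def sum.distrib algebra_simps)

lemma form_diff_right: "form n m k p (q - q') = form n m k p q - form n m k p q'"
  by (simp add: form_def sum_subtractf algebra_simps)

lemma form_smul_right: "form n m k p (smul c q) = c * form n m k p q"
  by (simp add: form_def sum_distrib_left algebra_simps)

lemma form_0_right: "form n m k p 0 = 0"
  by (simp add: form_def)

lemma form_add_left: "form n m k (p + p') q = form n m k p q + form n m k p' q"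
  by (simp add: form_sym[of _ _ _ _ q] form_add_right)

lemma form_diff_left: "form n m k (p - p') q = form n m k p q - form n m k p' q"
  by (simp add: form_sym[of _ _ _ _ q] form_diff_right)

lemma form_smul_left: "form n m k (smul c p) q = c * form n m k p q"
  by (simp add: form_sym[of _ _ _ _ q] form_smul_right)

text \<open>Made for the adjunction below: adding one variable matches the monomials that contribute
  to the two forms, and outside the matched sets the summands vanish.\<close>

lemma sum_eq_via_bij_on_supports:
  assumes "finite S" "finite T" "bij_betw i T' S'" "S' \<subseteq> S" "T' \<subseteq> T"
    and "\<And>x. x \<in> S - S' \<Longrightarrow> g x = 0" "\<And>x. x \<in> T - T' \<Longrightarrow> h x = 0"
    and "\<And>x. x \<in> T' \<Longrightarrow> g (i x) = h x"
  shows "sum g S = sum h T"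
proof -
  have "sum g S = sum g S'" using assms by (intro sum.mono_neutral_right) auto
  also have "\<dots> = sum (\<lambda>x. g (i x)) T'" using assms(3) by (simp add: sum.reindex_bij_betw)
  also have "\<dots> = sum h T'" using assms(8) by (intro sum.cong) auto
  also have "\<dots> = sum h T" using assms by (intro sum.mono_neutral_left) auto
  finally show ?thesis .
qed

lemma form_mul_ev:
  assumes "e \<in> {1..2*n}"
  shows "form n m (Suc k) (mul_ev e p) q = form n m k p (der_ev e q)"
  unfolding form_def
proof (rule sum_eq_via_bij_on_supports)
  have upd: "a(e := Suc (a e - Suc 0)) = a" if "0 < a e" for a :: "nat \<Rightarrow> nat"
    using that by auto
  show "bij_betw (\<lambda>(a, U). (a(e := Suc (a e)), U)) (Mon n m k) {\<mu> \<in> Mon n m (Suc k). 0 < fst \<mu> e}"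
  proof (rule bij_betw_byWitness[where f' = "\<lambda>(a, U). (a(e := a e - 1), U)"])
    show "(\<lambda>(a, U). (a(e := a e - 1), U)) ` {\<mu> \<in> Mon n m (Suc k). 0 < fst \<mu> e} \<subseteq> Mon n m k"
    proof safe
      fix a U assume "(a, U) \<in> Mon n m (Suc k)" "0 < fst (a, U) e"
      then show "(a(e := a e - 1), U) \<in> Mon n m k"
        using Mon_upd[OF assms, of "a(e := a e - 1)" U m k] by (simp add: upd)
    qed
  qed (auto simp: Mon_upd[OF assms] upd)
qed (auto simp: finite_Mon mul_ev_def der_ev_def wt_upd[OF assms])

lemma form_mul_od:
  assumes "t \<in> {1..2*m}"
  shows "form n m (Suc k) (mul_od t p) q = od_sign m t * form n m k p (der_od t q)"
  unfolding form_def sum_distrib_left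
proof (rule sum_eq_via_bij_on_supports)
  show "bij_betw (\<lambda>(a, U). (a, insert t U)) {\<mu> \<in> Mon n m k. t \<notin> snd \<mu>} {\<mu> \<in> Mon n m (Suc k). t \<in> snd \<mu>}"
  proof (rule bij_betw_byWitness[where f' = "\<lambda>(a, U). (a, U - {t})"])
    show "(\<lambda>(a, U). (a, U - {t})) ` {\<mu> \<in> Mon n m (Suc k). t \<in> snd \<mu>} \<subseteq> {\<mu> \<in> Mon n m k. t \<notin> snd \<mu>}"
    proof safe
      fix a U assume "(a, U) \<in> Mon n m (Suc k)" "t \<in> snd (a, U)"
      then show "(a, U - {t}) \<in> Mon n m k"
        using Mon_insert[OF assms, of "U - {t}" a n k] by (simp add: insert_absorb)
    qed simp
  qed (auto simp: Mon_insert[OF assms])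
qed (auto simp: finite_Mon mul_od_def der_od_def wt_insert[OF assms] osign_insert)

lemma form_0_mul_ev:
  assumes "e \<in> {1..2*n}"
  shows "form n m 0 (mul_ev e p) q = 0"
  unfolding form_def
proof (intro sum.neutral ballI)
  fix \<mu> assume "\<mu> \<in> Mon n m 0"
  then have "fst \<mu> e = 0"
    using member_le_sum[OF assms, of "fst \<mu>"] by (simp add: Mon_def mdeg_def)
  then show "wt n m \<mu> * (mul_ev e p \<mu> * q \<mu>) = 0" by (cases \<mu>) (simp add: mul_ev_def)
qed

lemma form_0_mul_od: "t \<in> {1..2*m} \<Longrightarrow> form n m 0 (mul_od t p) q = 0"
  unfolding form_def
proof (intro sum.neutral ballI)
  fix \<mu> assume "\<mu> \<in> Mon n m 0"
  then have "snd \<mu> \<subseteq> {1..2*m}" "card (snd \<mu>) = 0"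
    unfolding Mon_def valid_mon_def mdeg_def mem_Collect_eq add_is_0 by blast+
  moreover from this(1) have "finite (snd \<mu>)" by (rule finite_subset) simp
  ultimately have "snd \<mu> = {}" by simp
  then show "wt n m \<mu> * (mul_od t p \<mu> * q \<mu>) = 0" by (cases \<mu>) (simp add: mul_od_def)
qed

lemma form_0_mul_right:
  "e \<in> {1..2*n} \<Longrightarrow> form n m 0 p (mul_ev e q) = 0"
  "t \<in> {1..2*m} \<Longrightarrow> form n m 0 p (mul_od t q) = 0"
  using form_0_mul_ev form_0_mul_od by (simp_all add: form_sym[of _ _ _ p])

lemma form_der_ev: "e \<in> {1..2*n} \<Longrightarrow> form n m k (der_ev e p) q = form n m (Suc k) p (mul_ev e q)"
  by (simp add: form_sym[of _ _ _ _ q] form_sym[of _ _ _ p] form_mul_ev)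

lemma od_sign_square: "od_sign m t * (od_sign m t * c) = c"
  by (simp add: od_sign_def)

lemma form_der_od: "t \<in> {1..2*m} \<Longrightarrow>
    form n m k (der_od t p) q = od_sign m t * form n m (Suc k) p (mul_od t q)"
  by (simp add: form_sym[of _ _ _ _ q] form_sym[of _ _ _ p] form_mul_od od_sign_square)

lemma form_mul_der:
  "\<lbrakk>e \<in> {1..2*n}; f \<in> {1..2*n}\<rbrakk> \<Longrightarrow>
    form n m k (mul_ev e (der_ev f p)) q = form n m k p (mul_ev f (der_ev e q))"
  "\<lbrakk>e \<in> {1..2*n}; t \<in> {1..2*m}\<rbrakk> \<Longrightarrow>
    form n m k (mul_ev e (der_od t p)) q = od_sign m t * form n m k p (mul_od t (der_ev e q))"
  "\<lbrakk>t \<in> {1..2*m}; e \<in> {1..2*n}\<rbrakk> \<Longrightarrow>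
    form n m k (mul_od t (der_ev e p)) q = od_sign m t * form n m k p (mul_ev e (der_od t q))"
  "\<lbrakk>s \<in> {1..2*m}; t \<in> {1..2*m}\<rbrakk> \<Longrightarrow>
    form n m k (mul_od s (der_od t p)) q =
      od_sign m s * od_sign m t * form n m k p (mul_od t (der_od s q))"
  by (cases k; simp add: form_0_mul_ev form_0_mul_od form_0_mul_right form_mul_ev form_mul_od
      form_der_ev form_der_od)+

text \<open>The sign in \<^const>\<open>wt\<close> is what makes this work: with positive weights, the relative
  sign of the two summands of the adjoint of an odd operator would be wrong.\<close>

lemma osp_op_adjoint:
  assumes "T \<in> osp_ops n m"
  obtains T' c where "T' \<in> osp_ops n m" "\<And>p q. form n m k (T p) q = c * form n m k p (T' q)"
  using assms
proof (cases rule: osp_ops_cases)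
  case (xx i j)
  show thesis
    by (rule that[OF osp_op_in_osp_ops(1)[OF xx(2,1)], of 1])
       (use xx in \<open>simp add: form_diff_left form_diff_right form_mul_der\<close>)
next
  case (tt r s)
  show thesis
    by (rule that[OF osp_op_in_osp_ops(2)[OF tt(2,1)], of 1])
       (use tt in \<open>simp add: form_diff_left form_diff_right form_mul_der od_sign_def\<close>)
next
  case (xt i r)
  show thesis
    by (rule that[OF osp_op_in_osp_ops(4)[OF xt(1,2)], of 1])
       (use xt in \<open>simp add: form_diff_left form_add_right form_mul_der od_sign_def\<close>)
next
  case (tx i r)
  show thesis
    by (rule that[OF osp_op_in_osp_ops(3)[OF tx(1,2)], of 1])
       (use tx in \<open>simp add: form_add_left form_diff_right form_mul_der od_sign_def\<close>)
next
  case (xy i j)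
  show thesis
    by (rule that[OF osp_op_in_osp_ops(6)[OF xy(1-3)], of "-1"])
       (use xy in \<open>simp add: form_diff_left form_diff_right form_mul_der od_sign_def\<close>)
next
  case (yx i j)
  show thesis
    by (rule that[OF osp_op_in_osp_ops(5)[OF yx(1-3)], of "-1"])
       (use yx in \<open>simp add: form_diff_left form_diff_right form_mul_der od_sign_def\<close>)
next
  case (vt r s)
  show thesis
    by (rule that[OF osp_op_in_osp_ops(8)[OF vt(1-3)], of "-1"])
       (use vt in \<open>simp add: form_add_left form_add_right form_mul_der od_sign_def\<close>)
next
  case (tv r s)
  show thesis
    by (rule that[OF osp_op_in_osp_ops(7)[OF tv(1-3)], of "-1"])
       (use tv in \<open>simp add: form_add_left form_add_right form_mul_der od_sign_def\<close>)
next
  case (xv i r)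
  show thesis
    by (rule that[OF osp_op_in_osp_ops(10)[OF xv(1,2)], of 1])
       (use xv in \<open>simp add: form_add_left form_diff_right form_mul_der od_sign_def\<close>)
next
  case (yt i r)
  show thesis
    by (rule that[OF osp_op_in_osp_ops(9)[OF yt(1,2)], of 1])
       (use yt in \<open>simp add: form_diff_left form_add_right form_mul_der od_sign_def\<close>)
qed

section \<open>Orthogonal complements and the dimension count\<close>

lemma submodule_orthogonal:
  assumes "submodule (osp_ops n m) V" "submodule (osp_ops n m) W"
  shows "submodule (osp_ops n m) {h \<in> V. \<forall>w\<in>W. form n m k w h = 0}"
proof -
  have "form n m k w (T h) = 0" if "T \<in> osp_ops n m" "\<forall>w\<in>W. form n m k w h = 0" "w \<in> W" for T h w
  proof -
    obtain T' c where T': "T' \<in> osp_ops n m" "\<And>p q. form n m k (T p) q = c * form n m k p (T' q)"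
      using osp_op_adjoint[OF \<open>T \<in> osp_ops n m\<close>, of k] by metis
    have "form n m k w (T h) = c * form n m k (T' w) h"
      using T'(2)[of h w] by (simp add: form_sym)
    with T' that assms(2) show ?thesis by (auto simp: submodule_iff)
  qed
  then show ?thesis
    using assms(1) unfolding submodule_iff spoly.subspace_def
    by (auto simp: form_add_right form_smul_right form_0_right)
qed

lemma Ak_finitely_spanned:
  obtains F where "finite F" "Ak n m k \<subseteq> spoly.span F"
proof
  define u :: "smon \<Rightarrow> spoly" where "u \<mu> = (\<lambda>\<nu>. if \<nu> = \<mu> then 1 else 0)" for \<mu>
  show "finite (u ` Mon n m k)" by (simp add: finite_Mon)
  show "Ak n m k \<subseteq> spoly.span (u ` Mon n m k)"
  proof
    fix p assume p: "p \<in> Ak n m k"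
    have "(\<Sum>\<mu>\<in>Mon n m k. smul (p \<mu>) (u \<mu>)) \<nu> = p \<nu>" for \<nu>
    proof -
      have "(\<Sum>\<mu>\<in>Mon n m k. smul (p \<mu>) (u \<mu>)) \<nu> = (\<Sum>\<mu>\<in>Mon n m k. if \<nu> = \<mu> then p \<mu> else 0)"
        unfolding sum_fun_apply by (rule sum.cong) (auto simp: u_def)
      also have "\<dots> = (if \<nu> \<in> Mon n m k then p \<nu> else 0)"
        by (simp add: finite_Mon)
      also have "\<dots> = p \<nu>" using AkD[OF p] by (cases \<nu>) (auto simp: Mon_def)
      finally show ?thesis .
    qed
    then have "p = (\<Sum>\<mu>\<in>Mon n m k. smul (p \<mu>) (u \<mu>))" by auto
    then show "p \<in> spoly.span (u ` Mon n m k)"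
      by (metis (no_types, lifting) imageI spoly.span_base spoly.span_scale spoly.span_sum)
  qed
qed

text \<open>By \<open>orth\<close> the map from V to the dual of W given by the form is injective,
  so dim V \<le> dim W. The count is carried out with independent sets: a vector outside W would
  give one more independent vector than the span can hold.\<close>

lemma subspace_eq_if_orthogonal_trivial:
  assumes V: "spoly.subspace V" "finite F" "V \<subseteq> spoly.span F"
    and W: "spoly.subspace W" "W \<subseteq> V"
    and orth: "\<And>h. h \<in> V \<Longrightarrow> (\<And>w. w \<in> W \<Longrightarrow> form n m k w h = 0) \<Longrightarrow> h = 0"
  shows "W = V"
proof (rule ccontr)
  assume "W \<noteq> V"
  with W obtain h where h: "h \<in> V" "h \<notin> W" by auto
  obtain C where C: "C \<subseteq> W" "spoly.independent C" "W \<subseteq> spoly.span C"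
    by (rule spoly.maximal_independent_subset)
  have spanC: "spoly.span C = W" using C W by (meson spoly.span_minimal subset_antisym)
  have fin: "finite C"
    using spoly.independent_span_bound[OF V(2) C(2)] C(1) W(2) V(3) by blast
  have ind: "spoly.independent (insert h C)"
    using C h spanC by (intro spoly.independent_insertI) auto
  \<comment> \<open>The map to the dual of W in coordinates: the functional with values
    \<open>form n m k c q\<close> on the basis \<open>C\<close> is stored as the vector of W having
    these coordinates.\<close>
  define \<phi> where "\<phi> q = (\<Sum>c\<in>C. smul (form n m k c q) c)" for q
  have lin: "lin \<phi>"
    by (rule linI) (simp_all add: \<phi>_def form_add_right form_smul_right spoly.scale_left_distrib
        sum.distrib spoly.scale_sum_right)
  have inj0: "q = 0" if "q \<in> V" "\<phi> q = 0" for q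
  proof (rule orth[OF that(1)])
    have C0: "form n m k c q = 0" if "c \<in> C" for c
      using spoly.independentD[OF C(2) fin, of "\<lambda>c. form n m k c q" c] \<open>\<phi> q = 0\<close> that
      by (simp add: \<phi>_def)
    fix w assume "w \<in> W"
    then have "w \<in> spoly.span C" using spanC by simp
    then show "form n m k w q = 0"
    proof (induction rule: spoly.span_induct_alt)
      show "form n m k 0 q = 0" by (simp add: form_def)
      show "form n m k (smul c x + y) q = 0" if "x \<in> C" "form n m k y q = 0" for c x y
        using C0[OF that(1)] that(2) by (simp only: form_add_left form_smul_left) simp
    qed
  qed
  have "spoly.span (insert h C) \<subseteq> V"
    using C W h V by (intro spoly.span_minimal) auto
  then have inj: "inj_on \<phi> (spoly.span (insert h C))"
    unfolding spoly.linear_inj_on_iff_eq_0[OF lin spoly.subspace_span] using inj0 by auto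
  have in_span: "\<phi> q \<in> spoly.span C" for q
    unfolding \<phi>_def by (intro spoly.span_sum spoly.span_scale spoly.span_base)
  have "spoly.independent (\<phi> ` insert h C)"
    using spoly.linear_independent_injective_image[OF lin ind inj] .
  moreover have "\<phi> ` insert h C \<subseteq> spoly.span C" using in_span by blast
  ultimately have "card (\<phi> ` insert h C) \<le> card C"
    using spoly.independent_span_bound[OF fin] by blast
  moreover have "card (\<phi> ` insert h C) = card (insert h C)"
    using inj by (intro card_image) (meson inj_on_subset spoly.span_superset)
  moreover have "card (insert h C) = Suc (card C)"
    using C h fin by (intro card_insert_disjoint) auto
  ultimately show False by linarith
qed

section \<open>Singular vectors\<close>

definition x1_pow :: "nat \<Rightarrow> spoly" where
  "x1_pow k = (\<lambda>\<mu>. if \<mu> = ((\<lambda>_. 0)(1 := k), {}) then 1 else 0)"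

lemma x1_pow_at: "x1_pow k ((\<lambda>_. 0)(1 := k), {}) = 1"
  by (simp add: x1_pow_def)

lemma x1_pow_nonzero: "x1_pow k \<noteq> 0"
  using x1_pow_at[of k] by (metis zero_fun_apply zero_neq_one)

lemma x1_mon_in_Mon:
  assumes "n > 0"
  shows "((\<lambda>_. 0)(1 := k), {}) \<in> Mon n m k"
  using assms by (simp add: Mon_def valid_mon_def mdeg_def)

lemma x1_pow_Hk:
  assumes "n > 0"
  shows "x1_pow k \<in> Hk n m k"
proof -
  have "x1_pow k \<in> Ak n m k"
    using x1_mon_in_Mon[OF assms, of k m] by (intro AkI) (auto simp: x1_pow_def Mon_def split: if_splits)
  moreover have "der_ev (n+i) (x1_pow k) = 0" if "i \<in> {1..n}" for i
  proof (intro ext, clarsimp simp: der_ev_def x1_pow_def)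
    fix a :: "nat \<Rightarrow> nat"
    assume "a(n+i := Suc (a (n+i))) = (\<lambda>_. 0)(Suc 0 := k)"
    from fun_cong[OF this, of "n+i"] that assms have False by simp
    then show "1 + complex_of_nat (a (n + i)) = 0" ..
  qed
  moreover have "der_od t (x1_pow k) = 0" for t
    by (auto simp: der_od_def x1_pow_def fun_eq_iff)
  ultimately show ?thesis
    by (simp add: Hk_iff Lap_eq lin_gen_simps)
qed

lemma form_x1_pow:
  assumes "n > 0"
  shows "form n m k (x1_pow k) (x1_pow k) \<noteq> 0"
proof -
  let ?\<mu> = "((\<lambda>_. 0)(1 := k), {}) :: smon"
  have "form n m k (x1_pow k) (x1_pow k) = (\<Sum>\<mu>\<in>Mon n m k. if \<mu> = ?\<mu> then wt n m \<mu> else 0)"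
    unfolding form_def by (rule sum.cong) (auto simp: x1_pow_def)
  also have "\<dots> = wt n m ?\<mu>"
    using x1_mon_in_Mon[OF assms, of k m] by (simp add: finite_Mon)
  also have "\<dots> \<noteq> 0"
    by (simp add: wt_def)
  finally show ?thesis .
qed

text \<open>The four relations say that f is killed by the nilradical of the parabolic subalgebra
  stabilising the line of x_1.\<close>

locale x1_singular =
  fixes n m k :: nat and f :: spoly
  assumes n: "n > 1" and f: "f \<in> Hk n m k"
    and xx: "\<And>j. j \<in> {2..n} \<Longrightarrow> mul_ev 1 (der_ev j f) = mul_ev (n+j) (der_ev (n+1) f)"
    and xy: "\<And>j. j \<in> {2..n} \<Longrightarrow> mul_ev 1 (der_ev (n+j) f) = mul_ev j (der_ev (n+1) f)"
    and xt: "\<And>r. r \<in> {1..m} \<Longrightarrow> mul_ev 1 (der_od r f) = mul_od (m+r) (der_ev (n+1) f)"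
    and xv: "\<And>r. r \<in> {1..m} \<Longrightarrow> mul_ev 1 (der_od (m+r) f) = - mul_od r (der_ev (n+1) f)"
begin

lemma f_Ak: "f \<in> Ak n m k"
  using f by (simp add: Hk_iff)

lemma mul_ev_1_at: "mul_ev 1 p (c(1 := Suc (c 1)), V) = p (c, V)"
  by (simp add: mul_ev_def)

text \<open>At y_1-exponent \<open>d\<close> or more, \<open>der_ev (n+1) f\<close> has no
  coefficients because \<open>d\<close> is maximal. The singular relations carry this over to the
  derivatives of \<open>f\<close> in all variables except x_1 and y_1, so a top monomial contains
  none of those.\<close>

lemma top_monomial:
  assumes top: "\<And>b V. f (b, V) \<noteq> 0 \<Longrightarrow> b (n+1) \<le> d"
    and b: "f (b, V) \<noteq> 0" "b (n+1) = d"
  shows "b = (\<lambda>_. 0)(1 := k - d, n+1 := d)" "V = {}" "d \<le> k"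
proof -
  have g: "der_ev (n+1) f (c, V) = 0" if "d \<le> c (n+1)" for c V
    using top[of "c(n+1 := c (n+1) + 1)" V] that by (force simp: der_ev_def)
  have mul_g: "mul_ev z (der_ev (n+1) f) (c, V) = 0" if "d \<le> c (n+1)" "z \<noteq> n+1" for z c V
    using that g[of "c(z := c z - 1)" V] by (auto simp: mul_ev_def)
  have mul_od_g: "mul_od t (der_ev (n+1) f) (c, V) = 0" if "d \<le> c (n+1)" for t c V
    using g[of c] that by (auto simp: mul_od_def)
  have ev: "der_ev e f (c, V) = 0" if "d \<le> c (n+1)" "e \<in> {1..2*n}" "e \<noteq> 1" "e \<noteq> n+1" for e c V
  proof -
    \<comment> \<open>The coefficient with one more x_1 is where the factor x_1 of the relation can
      be cancelled; its y_1-exponent is unchanged.\<close>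
    have c: "d \<le> (c(1 := Suc (c 1))) (n+1)" using that n by simp
    have "e \<in> {2..n} \<or> e - n \<in> {2..n} \<and> e = n + (e - n)"
      using that by auto
    then consider "e \<in> {2..n}" | j where "j \<in> {2..n}" "e = n+j" by blast
    then show ?thesis
    proof cases
      case 1
      then have "mul_ev 1 (der_ev e f) (c(1 := Suc (c 1)), V) = 0"
        unfolding xx[OF 1] by (intro mul_g c) simp
      then show ?thesis by (simp only: mul_ev_1_at)
    next
      case 2
      then have "mul_ev 1 (der_ev e f) (c(1 := Suc (c 1)), V) = 0"
        unfolding 2(2) xy[OF 2(1)] by (intro mul_g c) simp
      then show ?thesis by (simp only: mul_ev_1_at)
    qed
  qed
  have od: "der_od t f (c, V) = 0" if "d \<le> c (n+1)" "t \<in> {1..2*m}" for t c V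
  proof -
    have c: "d \<le> (c(1 := Suc (c 1))) (n+1)" using that n by simp
    have "t \<in> {1..m} \<or> t - m \<in> {1..m} \<and> t = m + (t - m)"
      using that by auto
    then consider "t \<in> {1..m}" | r where "r \<in> {1..m}" "t = m+r" by blast
    then show ?thesis
    proof cases
      case 1
      then have "mul_ev 1 (der_od t f) (c(1 := Suc (c 1)), V) = 0"
        unfolding xt[OF 1] by (intro mul_od_g c)
      then show ?thesis by (simp only: mul_ev_1_at)
    next
      case 2
      have "mul_od r (der_ev (n+1) f) (c(1 := Suc (c 1)), V) = 0"
        by (intro mul_od_g c)
      then have "mul_ev 1 (der_od t f) (c(1 := Suc (c 1)), V) = 0"
        unfolding 2(2) xv[OF 2(1)] uminus_apply by (simp only: minus_zero)
      then show ?thesis by (simp only: mul_ev_1_at)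
    qed
  qed
  from AkD[OF f_Ak b(1)] have v: "valid_mon n m (b, V)" and deg: "mdeg n (b, V) = k" by auto
  have zero: "b e = 0" if "e \<noteq> 1" "e \<noteq> n+1" for e
  proof (rule ccontr)
    assume "b e \<noteq> 0"
    moreover from this v have e: "e \<in> {1..2*n}" by (auto simp: valid_mon_def)
    ultimately have "der_ev e f (b(e := b e - 1), V) = of_nat (b e) * f (b, V)"
      by (simp add: der_ev_def)
    moreover have "der_ev e f (b(e := b e - 1), V) = 0"
      using b(2) that by (intro ev e) auto
    ultimately show False using \<open>b e \<noteq> 0\<close> b(1) by simp
  qed
  show V: "V = {}"
  proof (rule ccontr)
    assume "V \<noteq> {}"
    then obtain t where t: "t \<in> V" by auto
    with v have "t \<in> {1..2*m}" by (auto simp: valid_mon_def)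
    then have "der_od t f (b, V - {t}) = 0" using b(2) by (intro od) auto
    with t b(1) show False by (simp add: der_od_def insert_absorb osign_def)
  qed
  have "b = (\<lambda>_. 0)(1 := b 1, n+1 := d)" using b(2) zero by auto
  moreover have "b 1 + d = k"
  proof -
    have "(\<Sum>e\<in>{1..2*n}. b e) = (\<Sum>e\<in>{1,n+1}. b e)"
      using n zero by (intro sum.mono_neutral_right) auto
    with deg V b(2) n show ?thesis by (simp add: mdeg_def)
  qed
  ultimately show "b = (\<lambda>_. 0)(1 := k - d, n+1 := d)" "d \<le> k" by auto
qed

text \<open>The relation x_1 d_{x_2} f = y_2 d_{y_1} f lets one trade a factor x_1 y_1 for x_2 y_2,
  until no x_1 is left; the relation then forbids any remaining y_1.\<close>

lemma y1_degree_le: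
  "f ((\<lambda>_. 0)(1 := p, n+1 := q, 2 := s, n+2 := s), {}) \<noteq> 0 \<Longrightarrow> q \<le> p"
proof (induction p arbitrary: q s)
  case 0
  show ?case
  proof (rule ccontr)
    assume "\<not> q \<le> 0"
    then obtain q' where q: "q = Suc q'" by (cases q) auto
    \<comment> \<open>The extra y_2 is absorbed by the factor y_2 on the right of the relation,
      while the left side vanishes here for want of x_1.\<close>
    let ?c = "(\<lambda>_. 0)(1 := 0, n+1 := q', 2 := s, n+2 := Suc s) :: nat \<Rightarrow> nat"
    have "mul_ev (n+2) (der_ev (n+1) f) (?c, {}) = 0"
      using n by (subst xx[of 2, symmetric]) (auto simp: mul_ev_def)
    moreover have "(?c(n+2 := s))(n+1 := Suc q') = (\<lambda>_. 0)(1 := 0, n+1 := Suc q', 2 := s, n+2 := s)"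
      using n by (auto simp: fun_eq_iff)
    moreover have "mul_ev (n+2) (der_ev (n+1) f) (?c, {}) =
        of_nat (Suc q') * f ((?c(n+2 := s))(n+1 := Suc q'), {})"
      using n by (simp add: mul_ev_def der_ev_def)
    ultimately have "of_nat (Suc q') * f ((\<lambda>_. 0)(1 := 0, n+1 := Suc q', 2 := s, n+2 := s), {}) = 0"
      by (simp only:)
    then show False
      using 0 unfolding q mult_eq_0_iff of_nat_eq_0_iff by blast
  qed
next
  case (Suc p)
  show ?case
  proof (cases q)
    case (Suc q')
    \<comment> \<open>Here each side of the relation reads a single coefficient of \<open>f\<close>,
      with x_2 and y_2 balanced in both: exponents \<open>s\<close> on the right,
      \<open>Suc s\<close> on the left.\<close>
    let ?c = "(\<lambda>_. 0)(1 := Suc p, n+1 := q', 2 := s, n+2 := Suc s) :: nat \<Rightarrow> nat"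
    have "mul_ev 1 (der_ev 2 f) (?c, {}) = mul_ev (n+2) (der_ev (n+1) f) (?c, {})"
      using n xx[of 2] by simp
    moreover have "(?c(n+2 := s))(n+1 := Suc q') = (\<lambda>_. 0)(1 := Suc p, n+1 := Suc q', 2 := s, n+2 := s)"
      and "(?c(1 := p))(2 := Suc s) = (\<lambda>_. 0)(1 := p, n+1 := q', 2 := Suc s, n+2 := Suc s)"
      using n by (auto simp: fun_eq_iff)
    moreover have "mul_ev (n+2) (der_ev (n+1) f) (?c, {}) =
        of_nat (Suc q') * f ((?c(n+2 := s))(n+1 := Suc q'), {})"
      and "mul_ev 1 (der_ev 2 f) (?c, {}) = of_nat (Suc s) * f ((?c(1 := p))(2 := Suc s), {})"
      using n by (simp_all add: mul_ev_def der_ev_def)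
    ultimately have "of_nat (Suc s) * f ((\<lambda>_. 0)(1 := p, n+1 := q', 2 := Suc s, n+2 := Suc s), {}) =
        of_nat (Suc q') * f ((\<lambda>_. 0)(1 := Suc p, n+1 := Suc q', 2 := s, n+2 := s), {})"
      by (simp only:)
    then have "f ((\<lambda>_. 0)(1 := p, n+1 := q', 2 := Suc s, n+2 := Suc s), {}) \<noteq> 0"
      using Suc.prems unfolding Suc by (metis mult_eq_0_iff of_nat_eq_0_iff nat.distinct(1))
    from Suc.IH[OF this] Suc show ?thesis by simp
  qed simp
qed

text \<open>Multiplying \<open>Lap n m f\<close> by x_1 lets the singular relations turn every dual
  pair into derivatives in y_1. At the chosen monomial the pair x_1, y_1 gives p + 1 times
  \<open>?D\<close>, each of the other n - 1 even pairs gives \<open>?D\<close> and each odd pair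
  gives its negative, so p + 1 + (n - 1) - m = 0.\<close>

lemma top_degree_equation:
  assumes f0: "f ((\<lambda>_. 0)(1 := Suc p, n+1 := Suc d), {}) \<noteq> 0"
  shows "int p + int n = int m"
proof -
  let ?c = "(\<lambda>_. 0)(1 := Suc p, n+1 := d) :: nat \<Rightarrow> nat"
  let ?D = "der_ev (n+1) f (?c, {})"
  have c: "?c(n+1 := Suc d) = (\<lambda>_. 0)(1 := Suc p, n+1 := Suc d)" "?c (n+1) = d"
    using n by auto
  have "?D = of_nat (Suc d) * f (?c(n+1 := Suc d), {})"
    using n by (simp add: der_ev_def)
  then have D: "?D \<noteq> 0" using f0 unfolding c(1) by (simp del: of_nat_Suc)
  have 1: "mul_ev 1 (der_ev 1 (der_ev (n+1) f)) (?c, {}) = of_nat (Suc p) * ?D"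
    using n by (simp add: mul_ev_def der_ev_def fun_upd_twist)
  have ev: "mul_ev 1 (der_ev i (der_ev (n+i) f)) (?c, {}) = ?D" if "i \<in> {2..n}" for i
  proof -
    have "mul_ev 1 (der_ev i (der_ev (n+i) f)) = der_ev i (mul_ev 1 (der_ev (n+i) f))"
      using that by (simp add: der_ev_mul_ev)
    also have "\<dots> = der_ev (n+1) f + mul_ev i (der_ev i (der_ev (n+1) f))"
      unfolding xy[OF that] by (simp add: der_ev_mul_ev)
    finally show ?thesis using that by (simp add: mul_ev_def)
  qed
  have od: "mul_ev 1 (der_od r (der_od (m+r) f)) (?c, {}) = - ?D" if "r \<in> {1..m}" for r
  proof -
    have "mul_ev 1 (der_od r (der_od (m+r) f)) = der_od r (mul_ev 1 (der_od (m+r) f))"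
      by (simp add: ev_od_commute)
    also have "\<dots> = mul_od r (der_od r (der_ev (n+1) f)) - der_ev (n+1) f"
      unfolding xv[OF that] by (simp add: der_od_mul_od lin_gen_simps)
    finally show ?thesis by (simp add: mul_od_def)
  qed
  have split: "{1..n} = insert 1 {2..n}" using n by auto
  have "0 = mul_ev 1 (Lap n m f) (?c, {})" using f by (simp add: Hk_iff lin_gen_simps)
  also have "\<dots> = (\<Sum>i=1..n. mul_ev 1 (der_ev i (der_ev (n+i) f)) (?c, {}))
      + (\<Sum>r=1..m. mul_ev 1 (der_od r (der_od (m+r) f)) (?c, {}))"
    by (simp only: Lap_eq lin_gen_simps lin_gen_sum plus_fun_apply sum_fun_apply)
  also have "(\<Sum>i=1..n. mul_ev 1 (der_ev i (der_ev (n+i) f)) (?c, {}))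
      = of_nat (Suc p) * ?D + (\<Sum>i\<in>{2..n}. ?D)"
    unfolding split using ev by (subst sum.insert) (auto simp only: 1 finite_atLeastAtMost intro!: arg_cong2[where f = "(+)"] sum.cong, auto)
  also have "(\<Sum>r=1..m. mul_ev 1 (der_od r (der_od (m+r) f)) (?c, {})) = (\<Sum>r=1..m. - ?D)"
    by (rule sum.cong[OF refl od])
  finally have "0 = of_nat (Suc p) * ?D + (\<Sum>i\<in>{2..n}. ?D) + (\<Sum>r=1..m. - ?D)" .
  also have "\<dots> = of_int (int p + int n - int m) * ?D"
    using n by (simp add: of_nat_diff algebra_simps)
  finally have "int p + int n - int m = 0"
    using D by (metis mult_eq_0_iff of_int_eq_0_iff)
  then show ?thesis by simp
qed

lemma singular_is_x1_pow:
  assumes k: "int k \<le> int m + 1 - int n \<or> int k > 2 * (int m + 1 - int n)" and "f \<noteq> 0"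
  shows "\<exists>c. c \<noteq> 0 \<and> f = smul c (x1_pow k)"
proof -
  have bound: "b (n+1) \<le> k" if "f (b, V) \<noteq> 0" for b V
    using AkD[OF f_Ak that] member_le_sum[of "n+1" "{1..2*n}" b] n by (simp add: mdeg_def)
  obtain b0 V0 where b0: "f (b0, V0) \<noteq> 0" using \<open>f \<noteq> 0\<close> by (auto simp: fun_eq_iff)
  have "\<exists>\<mu>. f \<mu> \<noteq> 0 \<and> (\<forall>\<nu>. f \<nu> \<noteq> 0 \<longrightarrow> fst \<nu> (n+1) \<le> fst \<mu> (n+1))"
    by (rule ex_has_greatest_nat[of _ "(b0, V0)" _ "Suc k"])
      (use b0 bound in \<open>auto simp: less_Suc_eq_le\<close>)
  then obtain b V where b: "f (b, V) \<noteq> 0" and top: "\<And>b' V'. f (b', V') \<noteq> 0 \<Longrightarrow> b' (n+1) \<le> b (n+1)"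
    by auto
  define d where "d = b (n+1)"
  have top': "b' (n+1) \<le> d" if "f (b', V') \<noteq> 0" for b' V'
    using top[OF that] by (simp add: d_def)
  have tm: "b' = (\<lambda>_. 0)(1 := k - d, n+1 := d)" "V' = {}" "d \<le> k"
    if "f (b', V') \<noteq> 0" "b' (n+1) = d" for b' V'
    using top_monomial[of d b' V', OF _ that] top' by blast+
  have bV: "b = (\<lambda>_. 0)(1 := k - d, n+1 := d)" "V = {}" "d \<le> k"
    using tm[OF b] by (auto simp: d_def)
  have "d = 0"
  proof (rule ccontr)
    assume "d \<noteq> 0"
    have "(\<lambda>_. 0)(1 := k - d, n+1 := d, 2 := 0, n+2 := 0) = b" unfolding bV(1) using n by auto
    then have "d \<le> k - d" using y1_degree_le[of "k - d" d 0] b bV(2) by simp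
    \<comment> \<open>The inequality d \<le> k - d has two uses: it makes the x_1-exponent positive,
      as the degree equation requires, and together with p = M - 1, that is d = k - M, it yields M <
      k \<le> 2M.\<close>
    then obtain p d' where p: "k - d = Suc p" and d': "d = Suc d'"
      using \<open>d \<noteq> 0\<close> by (metis Suc_le_D not0_implies_Suc)
    have "int p + int n = int m"
      using top_degree_equation[of p d'] b bV p d' by simp
    moreover have "k = d + Suc p" using p bV(3) by simp
    ultimately show False using k d' \<open>d \<le> k - d\<close> p by presburger
  qed
  have b1: "b = (\<lambda>_. 0)(1 := k)"
    using bV(1) \<open>d = 0\<close> n by (auto simp: fun_eq_iff)
  have x1: "smul c (x1_pow k) \<mu> = (if \<mu> = (b, V) then c else 0)" for c \<mu>
    unfolding smul_apply x1_pow_def b1[symmetric] bV(2) by simp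
  have "f (b', V') = smul (f (b, V)) (x1_pow k) (b', V')" for b' V'
  proof (cases "f (b', V') = 0")
    case True
    with b have "(b', V') \<noteq> (b, V)" by auto
    with True show ?thesis unfolding x1 by auto
  next
    case False
    \<comment> \<open>Once d = 0, every monomial of \<open>f\<close> has the top y_1-degree, so the
      description of top monomials applies to all of them.\<close>
    with top[OF False] \<open>d = 0\<close> have "b' (n+1) = d" by (simp add: d_def)
    with tm[OF False] bV have "b' = b" "V' = V" by simp_all
    then show ?thesis unfolding x1 by simp
  qed
  then have "f = smul (f (b, V)) (x1_pow k)"
    unfolding fun_eq_iff split_paired_All by blast
  with b show ?thesis by blast
qed

end

section \<open>Irreducibility\<close>

text \<open>The summand k keeps the x_1-degree minus the y_1-degree, which is at least -k in degree k,
  nonnegative.\<close>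

definition weight_ge :: "nat \<Rightarrow> nat \<Rightarrow> nat \<Rightarrow> spoly \<Rightarrow> bool" where
  "weight_ge n k N f \<longleftrightarrow> (\<forall>a U. f (a, U) \<noteq> 0 \<longrightarrow> N + a (n+1) \<le> k + a 1)"

lemma weight_ge_add: "weight_ge n k N f \<Longrightarrow> weight_ge n k N g \<Longrightarrow> weight_ge n k N (f + g)"
  unfolding weight_ge_def by (metis add.right_neutral plus_fun_apply)

lemma weight_ge_diff: "weight_ge n k N f \<Longrightarrow> weight_ge n k N g \<Longrightarrow> weight_ge n k N (f - g)"
  unfolding weight_ge_def by (metis diff_self minus_apply)

lemma weight_ge_mul_x1:
  "weight_ge n k N f \<Longrightarrow> n > 0 \<Longrightarrow> weight_ge n k (Suc N) (mul_ev 1 f)"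
  unfolding weight_ge_def mul_ev_def by (force split: if_splits)

lemma weight_ge_der_y1:
  "weight_ge n k N f \<Longrightarrow> n > 0 \<Longrightarrow> weight_ge n k (Suc N) (der_ev (n+1) f)"
  unfolding weight_ge_def der_ev_def by force

lemma weight_ge_mul_ev:
  "weight_ge n k N f \<Longrightarrow> e \<noteq> 1 \<Longrightarrow> e \<noteq> n+1 \<Longrightarrow> weight_ge n k N (mul_ev e f)"
  unfolding weight_ge_def mul_ev_def by (force split: if_splits)

lemma weight_ge_der_ev:
  "weight_ge n k N f \<Longrightarrow> e \<noteq> 1 \<Longrightarrow> e \<noteq> n+1 \<Longrightarrow> weight_ge n k N (der_ev e f)"
  unfolding weight_ge_def der_ev_def by force

lemma weight_ge_mul_od: "weight_ge n k N f \<Longrightarrow> weight_ge n k N (mul_od t f)"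
  unfolding weight_ge_def mul_od_def by (force split: if_splits)

lemma weight_ge_der_od: "weight_ge n k N f \<Longrightarrow> weight_ge n k N (der_od t f)"
  unfolding weight_ge_def der_od_def by (force split: if_splits)

lemmas weight_ge_intros = weight_ge_mul_x1 weight_ge_der_y1 weight_ge_mul_ev weight_ge_der_ev
  weight_ge_mul_od weight_ge_der_od weight_ge_add weight_ge_diff

text \<open>Maximising a lower bound for the weights of all monomials replaces the splitting of
  \<open>W\<close> into weight spaces: a raising operator improves the bound of an optimal vector,
  so its value must be 0.\<close>

lemma x1_pow_in_submodule:
  assumes n: "n > 1"
    and k: "int k \<le> int m + 1 - int n \<or> int k > 2 * (int m + 1 - int n)"
    and W: "submodule (osp_ops n m) W" "W \<subseteq> Hk n m k" "W \<noteq> {0}"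
  shows "x1_pow k \<in> W"
proof -
  define P where "P N \<longleftrightarrow> (\<exists>f\<in>W. f \<noteq> 0 \<and> weight_ge n k N f)" for N
  have W0: "spoly.subspace W" and op: "\<And>T f. T \<in> osp_ops n m \<Longrightarrow> f \<in> W \<Longrightarrow> T f \<in> W"
    using W(1) by (auto simp: submodule_iff)
  have exp_le: "a e \<le> k" if "f \<in> W" "f (a, U) \<noteq> 0" "e \<in> {1..2*n}" for f a U e
  proof -
    have "mdeg n (a, U) = k" using that W(2) AkD[of f n m k a U] by (auto simp: Hk_iff)
    then show ?thesis using member_le_sum[of e "{1..2*n}" a] that(3) by (simp add: mdeg_def)
  qed
  obtain f0 where "f0 \<in> W" "f0 \<noteq> 0" using W(3) spoly.subspace_0[OF W0] by blast
  moreover have "weight_ge n k 0 f0"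
    unfolding weight_ge_def using exp_le[OF \<open>f0 \<in> W\<close>, of _ _ "n+1"] n by (force simp: trans_le_add1)
  ultimately have "P 0" by (auto simp: P_def)
  moreover have "N \<le> 2*k" if "P N" for N
  proof -
    from that obtain f where f: "f \<in> W" "f \<noteq> 0" "weight_ge n k N f" by (auto simp: P_def)
    then obtain a U where a: "f (a, U) \<noteq> 0" by (auto simp: fun_eq_iff)
    with f(3) exp_le[OF f(1) a, of 1] n show ?thesis by (force simp: weight_ge_def)
  qed
  \<comment> \<open>In degree k the weights lie between -k and k, which after the shift by k bounds
    N by 2k.\<close>
  ultimately obtain N where "P N" and N: "\<And>N'. P N' \<Longrightarrow> N' \<le> N"
    using GreatestI_nat[of P 0 "2*k"] Greatest_le_nat[of P _ "2*k"] by blast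
  then obtain f where fW: "f \<in> W" "f \<noteq> 0" "weight_ge n k N f" by (auto simp: P_def)
  have zero: "g = 0" if "g \<in> W" "weight_ge n k (Suc N) g" for g
    using N[of "Suc N"] that by (auto simp: P_def)
  interpret x1_singular n m k f
  proof
    show "n > 1" "f \<in> Hk n m k" using n fW(1) W(2) by auto
    show "mul_ev 1 (der_ev j f) = mul_ev (n+j) (der_ev (n+1) f)" if "j \<in> {2..n}" for j
    proof -
      have "mul_ev 1 (der_ev j f) - mul_ev (n+j) (der_ev (n+1) f) = 0"
        using that n fW
        by (intro zero op[OF osp_op_in_osp_ops(1)] weight_ge_intros) auto
      then show ?thesis by simp
    qed
    show "mul_ev 1 (der_ev (n+j) f) = mul_ev j (der_ev (n+1) f)" if "j \<in> {2..n}" for j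
    proof -
      have "mul_ev 1 (der_ev (n+j) f) - mul_ev j (der_ev (n+1) f) = 0"
        using that n fW
        by (intro zero op[OF osp_op_in_osp_ops(5)] weight_ge_intros) auto
      then show ?thesis by simp
    qed
    show "mul_ev 1 (der_od r f) = mul_od (m+r) (der_ev (n+1) f)" if "r \<in> {1..m}" for r
    proof -
      have "mul_ev 1 (der_od r f) - mul_od (m+r) (der_ev (n+1) f) = 0"
        using that n fW
        by (intro zero op[OF osp_op_in_osp_ops(3)] weight_ge_intros) auto
      then show ?thesis by simp
    qed
    show "mul_ev 1 (der_od (m+r) f) = - mul_od r (der_ev (n+1) f)" if "r \<in> {1..m}" for r
    proof -
      have "mul_ev 1 (der_od (m+r) f) + mul_od r (der_ev (n+1) f) = 0"
        using that n fW
        by (intro zero op[OF osp_op_in_osp_ops(9)] weight_ge_intros) auto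
      then show ?thesis by (simp only: eq_neg_iff_add_eq_0)
    qed
  qed
  obtain c where c: "c \<noteq> 0" "f = smul c (x1_pow k)"
    using singular_is_x1_pow[OF k fW(2)] by blast
  then have "x1_pow k = smul (inverse c) f" by simp
  then show ?thesis using fW(1) spoly.subspace_scale[OF W0] by metis
qed

lemma irreducible_submodule_iff:
  "irreducible_submodule ops V \<longleftrightarrow> submodule ops V \<and> V \<noteq> {0} \<and>
    (\<forall>W. submodule ops W \<and> W \<subseteq> V \<longrightarrow> W = {0} \<or> W = V)"
  by (simp add: irreducible_submodule_def zero_fun_def)

lemma Hk_irreducible:
  assumes n: "n > 1"
    and k: "int k \<le> int m + 1 - int n \<or> int k > 2 * (int m + 1 - int n)"
  shows "irreducible_submodule (osp_ops n m) (Hk n m k)"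
  unfolding irreducible_submodule_iff
proof (intro conjI allI impI; (elim conjE)?)
  show "submodule (osp_ops n m) (Hk n m k)" by (rule submodule_Hk)
  show "Hk n m k \<noteq> {0}" using x1_pow_Hk[of n k m] x1_pow_nonzero[of k] n by auto
  fix W assume W: "submodule (osp_ops n m) W" "W \<subseteq> Hk n m k"
  show "W = {0} \<or> W = Hk n m k"
  proof (cases "W = {0}")
    case False
    let ?Z = "{h \<in> Hk n m k. \<forall>w\<in>W. form n m k w h = 0}"
    have "x1_pow k \<in> W" by (rule x1_pow_in_submodule[OF n k W False])
    then have "x1_pow k \<notin> ?Z" using form_x1_pow[of n m k] n by auto
    then have Z: "?Z = {0}"
      using x1_pow_in_submodule[OF n k submodule_orthogonal[OF submodule_Hk W(1)]] by blast
    obtain F where "finite F" "Ak n m k \<subseteq> spoly.span F" by (rule Ak_finitely_spanned)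
    moreover have "Hk n m k \<subseteq> Ak n m k" by (auto simp: Hk_iff)
    ultimately have "W = Hk n m k"
      using W submodule_Hk[of n m k] Z
      by (intro subspace_eq_if_orthogonal_trivial[of "Hk n m k" F W n m k]) (auto simp: submodule_iff)
    then show ?thesis ..
  qed simp
qed

section \<open>Reducibility in the range M < k \<le> 2M\<close>

lemma eta_at:
  assumes "n > 0"
  shows "eta n m p ((\<lambda>_. 0)(1 := a, n+1 := b), {}) =
    (if 0 < a \<and> 0 < b then p ((\<lambda>_. 0)(1 := a - 1, n+1 := b - 1), {}) else 0)"
proof -
  let ?c = "(\<lambda>_. 0)(1 := a, n+1 := b) :: nat \<Rightarrow> nat"
  have upd: "?c(1 := a - 1, n+1 := b - 1) = (\<lambda>_. 0)(1 := a - 1, n+1 := b - 1)"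
    using assms by (auto simp: fun_eq_iff)
  have "mul_ev i (mul_ev (n+i) p) (?c, {}) =
      (if i = 1 then (if 0 < a \<and> 0 < b then p (?c(1 := a - 1, n+1 := b - 1), {}) else 0) else 0)"
    if "i \<in> {1..n}" for i
    using that by (auto simp: mul_ev_def)
  then have "(\<Sum>i=1..n. mul_ev i (mul_ev (n+i) p) (?c, {})) =
      (if 0 < a \<and> 0 < b then p (?c(1 := a - 1, n+1 := b - 1), {}) else 0)"
    using assms by simp
  then show ?thesis unfolding upd
    by (simp add: eta_eq sum_fun_apply mul_od_def)
qed

text \<open>Only the summand x_1 y_1 of \<open>eta\<close> can produce a monomial in x_1 and y_1
  alone, so the coefficient of x_1^(l+i) y_1^i stays 1.\<close>

lemma eta_pow_x1_pow_nonzero: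
  assumes "n > 0"
  shows "(eta n m ^^ i) (x1_pow l) \<noteq> 0"
proof -
  have "(eta n m ^^ i) (x1_pow l) ((\<lambda>_. 0)(1 := l + i, n+1 := i), {}) = 1"
  proof (induction i)
    case 0
    have "(\<lambda>_. 0)(1 := l, n+1 := 0) = (\<lambda>_. 0)(1 := l)" using assms by auto
    then show ?case using x1_pow_at[of l] by (simp only: funpow_0 add_0_right)
  next
    case (Suc i)
    then show ?case
      by (simp only: funpow.simps comp_apply eta_at[OF assms] add_Suc_right diff_Suc_1
          zero_less_Suc simp_thms if_True)
  qed
  then show ?thesis by (metis zero_fun_apply zero_neq_one)
qed

lemma Hk_reducible:
  assumes n: "n > 0"
    and k: "int m + 1 - int n < int k" "int k \<le> 2 * (int m + 1 - int n)"
  shows "\<not> irreducible_submodule (osp_ops n m) (Hk n m k)"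
proof
  assume irr: "irreducible_submodule (osp_ops n m) (Hk n m k)"
  let ?Z = "Hk n m k \<inter> range (eta n m)"
  have "submodule (osp_ops n m) ?Z"
    unfolding submodule_iff
  proof (intro conjI ballI)
    have "spoly.subspace (Hk n m k)" using submodule_Hk by (simp add: submodule_iff)
    moreover have "spoly.subspace (range (eta n m))"
      by (rule spoly.linear_subspace_image[OF lin_eta spoly.subspace_UNIV])
    ultimately show "spoly.subspace ?Z" by (rule spoly.subspace_inter)
    fix T f assume T: "T \<in> osp_ops n m" and f: "f \<in> ?Z"
    then obtain p where "f = eta n m p" by blast
    with T have "T f = eta n m (T p)" by (simp add: eta_osp_op)
    moreover have "T f \<in> Hk n m k" using T f submodule_Hk[of n m k] by (simp add: submodule_iff)
    ultimately show "T f \<in> ?Z" by blast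
  qed
  then have Z: "?Z = {0} \<or> ?Z = Hk n m k" using irr by (auto simp: irreducible_submodule_iff)
  \<comment> \<open>The solution of l + 2(i+1) = k and n - m + l + i = 0. It consists of natural
    numbers because k \<le> 2M gives l \<ge> 0 and M < k gives i \<ge> 0.\<close>
  define l where "l = nat (2 * (int m + 1 - int n) - int k)"
  define i where "i = nat (int k - (int m + 1 - int n) - 1)"
  have l: "l + 2 * Suc i = k" "int n - int m + int l + int i = 0"
    using k by (simp_all add: l_def i_def)
  have "Lap n m ((eta n m ^^ Suc i) (x1_pow l)) = 0"
    unfolding Lap_eta_pow[OF x1_pow_Hk[OF n]] l(2) by simp
  then have "(eta n m ^^ Suc i) (x1_pow l) \<in> Hk n m k"
    using Ak_eta_pow[of "x1_pow l" n m l "Suc i"] x1_pow_Hk[OF n, of l m]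
    unfolding Hk_iff l(1) by blast
  then have "(eta n m ^^ Suc i) (x1_pow l) \<in> ?Z" by simp
  moreover have "(eta n m ^^ Suc i) (x1_pow l) \<noteq> 0" by (rule eta_pow_x1_pow_nonzero[OF n])
  ultimately have "?Z = Hk n m k" using Z by blast
  then have "x1_pow k \<in> range (eta n m)" using x1_pow_Hk[OF n, of k m] by blast
  then obtain p where p: "x1_pow k = eta n m p" by auto
  \<comment> \<open>Read with y_1-exponent 0, this monomial has coefficient 0 in every multiple of
    \<open>eta\<close>, but 1 in \<open>x1_pow k\<close>.\<close>
  have "(\<lambda>_. 0)(1 := k, n+1 := 0) = (\<lambda>_. 0)(1 := k)" using n by auto
  then show False using eta_at[OF n, of m p k 0] x1_pow_at[of k] p by simp
qed

lemma eta_pow_osp_op: "T \<in> osp_ops n m \<Longrightarrow> (eta n m ^^ i) (T p) = T ((eta n m ^^ i) p)"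
  by (induction i) (simp_all add: eta_osp_op)

text \<open>A submodule of the image pulls back along \<open>L\<close> to a submodule of
  \<open>V\<close>, of which it is again the image; injectivity keeps the image nonzero.\<close>

lemma irreducible_submodule_image:
  assumes irr: "irreducible_submodule ops V" and L: "lin L"
    and comm: "\<And>T p. T \<in> ops \<Longrightarrow> L (T p) = T (L p)"
    and inj: "\<And>h. h \<in> V \<Longrightarrow> L h = 0 \<Longrightarrow> h = 0"
  shows "irreducible_submodule ops (L ` V)"
  unfolding irreducible_submodule_iff
proof (intro conjI allI impI; (elim conjE)?)
  have V: "spoly.subspace V" "\<And>T f. T \<in> ops \<Longrightarrow> f \<in> V \<Longrightarrow> T f \<in> V" and "V \<noteq> {0}"
    and min: "\<And>W. submodule ops W \<Longrightarrow> W \<subseteq> V \<Longrightarrow> W = {0} \<or> W = V"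
    using irr by (auto simp: irreducible_submodule_iff submodule_iff)
  show "submodule ops (L ` V)"
    unfolding submodule_iff using spoly.linear_subspace_image[OF L V(1)] V(2)
    by (auto simp flip: comm)
  show "L ` V \<noteq> {0}"
    using \<open>V \<noteq> {0}\<close> inj spoly.subspace_0[OF V(1)] by (metis empty_iff image_eqI singletonD subsetI subset_antisym insert_subset)
  fix W assume W: "submodule ops W" "W \<subseteq> L ` V"
  let ?P = "V \<inter> L -` W"
  have "submodule ops ?P"
    using W(1) V spoly.subspace_inter[OF V(1) spoly.linear_subspace_vimage[OF L]]
    by (auto simp: submodule_iff comm)
  then have "?P = {0} \<or> ?P = V" using min by blast
  moreover have "W = L ` ?P" using W(2) by auto
  ultimately show "W = {0} \<or> W = L ` V"
    using spoly.linear_0[OF L] by auto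
qed

theorem theorem4p1:
  fixes n m k :: nat
  assumes "n > 1" and "m > 0"
  shows "(irreducible_submodule (osp_ops n m) (Hk n m k) \<longleftrightarrow>
            (int k \<le> int m + 1 - int n \<or> int k > 2 * (int m + 1 - int n)))
       \<and> (int k \<le> int m + 1 - int n \<longrightarrow>
            (\<forall>i \<le> k div 2. (eta n m ^^ i) ` Hk n m (k - 2*i) \<subseteq> Ak n m k
                 \<and> irreducible_submodule (osp_ops n m) ((eta n m ^^ i) ` Hk n m (k - 2*i)))
          \<and> (\<forall>f \<in> Ak n m k. \<exists>h. (\<forall>i \<le> k div 2. h i \<in> Hk n m (k - 2*i))
                 \<and> f = (\<lambda>\<mu>. \<Sum>i\<le>k div 2. (eta n m ^^ i) (h i) \<mu>))
          \<and> (\<forall>h. (\<forall>i \<le> k div 2. h i \<in> Hk n m (k - 2*i))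
                 \<and> (\<lambda>\<mu>. \<Sum>i\<le>k div 2. (eta n m ^^ i) (h i) \<mu>) = (\<lambda>_. 0)
                 \<longrightarrow> (\<forall>i \<le> k div 2. (eta n m ^^ i) (h i) = (\<lambda>_. 0))))"
proof (intro conjI impI)
  have "n > 0" using assms(1) by simp
  show "irreducible_submodule (osp_ops n m) (Hk n m k) \<longleftrightarrow>
      (int k \<le> int m + 1 - int n \<or> int k > 2 * (int m + 1 - int n))"
    using Hk_irreducible[OF assms(1), of k m] Hk_reducible[OF \<open>n > 0\<close>, of m k] by linarith
next
  assume k: "int k \<le> int m + 1 - int n"
  have sum: "(\<lambda>\<mu>. \<Sum>i\<le>N. g i \<mu>) = (\<Sum>i\<le>N. g i)" for N and g :: "nat \<Rightarrow> spoly"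
    by (simp add: fun_eq_iff sum_fun_apply)
  show "\<forall>i \<le> k div 2. (eta n m ^^ i) ` Hk n m (k - 2*i) \<subseteq> Ak n m k
      \<and> irreducible_submodule (osp_ops n m) ((eta n m ^^ i) ` Hk n m (k - 2*i))"
  proof (intro allI impI conjI)
    fix i assume "i \<le> k div 2"
    then have i: "2 * i \<le> k" by simp
    then show "(eta n m ^^ i) ` Hk n m (k - 2*i) \<subseteq> Ak n m k"
      using Ak_eta_pow[of _ n m "k - 2*i" i] by (auto simp: Hk_iff)
    show "irreducible_submodule (osp_ops n m) ((eta n m ^^ i) ` Hk n m (k - 2*i))"
    proof (rule irreducible_submodule_image[OF _ lin_eta_pow eta_pow_osp_op])
      \<comment> \<open>Lowering the degree keeps it at most M, so the irreducibility criterion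
        applies to every summand.\<close>
      show "irreducible_submodule (osp_ops n m) (Hk n m (k - 2*i))"
        using k by (intro Hk_irreducible assms(1)) linarith
    qed (auto intro: eta_pow_eq_0D[OF k i])
  qed
  show "\<forall>f \<in> Ak n m k. \<exists>h. (\<forall>i \<le> k div 2. h i \<in> Hk n m (k - 2*i))
      \<and> f = (\<lambda>\<mu>. \<Sum>i\<le>k div 2. (eta n m ^^ i) (h i) \<mu>)"
    unfolding sum using harmonic_decomposition_exists[OF k] by blast
  show "\<forall>h. (\<forall>i \<le> k div 2. h i \<in> Hk n m (k - 2*i))
      \<and> (\<lambda>\<mu>. \<Sum>i\<le>k div 2. (eta n m ^^ i) (h i) \<mu>) = (\<lambda>_. 0)
      \<longrightarrow> (\<forall>i \<le> k div 2. (eta n m ^^ i) (h i) = (\<lambda>_. 0))"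
    unfolding sum zero_fun_def[symmetric] using harmonic_decomposition_unique[OF k] by blast
qed

end
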